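(* Let $R$ be a factorial domain, $B=R[T_1,\ldots,T_n]$, $h=f_1T_1+\cdots+f_nT_n+f$ a forcing equation with $f_1,\ldots,f_n,f\in R$, and $A=B/(h)$. Let $d$ be a greatest common divisor of $f_1,\ldots,f_n$ and $f$, and assume that at least one $f_i\neq 0$. If $\gcd(d,f_1/d,\ldots,f_n/d)=1$, then $\operatorname{Spec} A$ is connected. Moreover, if $R$ is a principal ideal domain, then the condition $\gcd(d,f_1/d,\ldots,f_n/d)=1$ is equivalent to $\operatorname{Spec} A$ being connected.
   Context: A factorial domain is a unique factorization domain. Greatest common divisors are defined up to units; $\gcd=1$ means that the elements have no common irreducible factor. The empty topological space is not considered connected. *)

theory Defs
  imports
    "HOL-Algebra.Ideal"
    "HOL-Algebra.QuotRing"
    "HOL-Algebra.Ring_Divisibility"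
    "HOL-Algebra.Indexed_Polynomials"
    "HOL-Analysis.Abstract_Topology"
begin

section \<open>Polynomial rings in several variables\<close>

text \<open>\<^theory>\<open>HOL-Algebra.Indexed_Polynomials\<close> provides the set of polynomials over \<open>R\<close> in variables
  indexed by \<open>I\<close> (functions from monomials, i.e. multisets of variables, to coefficients), together
  with constants, variables and addition, but no product of two polynomials. The product below is
  the convolution over the factorisations of a monomial \<open>m\<close> as \<open>k + (m - k)\<close>.\<close>

definition poly_ring_in :: "('a, 'b) ring_scheme \<Rightarrow> 'c set \<Rightarrow> ('c multiset \<Rightarrow> 'a) ring" where
  "poly_ring_in R I =
    \<lparr> carrier = ring.indexed_pset R I (carrier R),
      monoid.mult = (\<lambda>P Q m. \<Oplus>\<^bsub>R\<^esub>k\<in>{k. k \<subseteq># m}. P k \<otimes>\<^bsub>R\<^esub> Q (m - k)),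
      one = ring.indexed_const R \<one>\<^bsub>R\<^esub>,
      ring.zero = ring.indexed_const R \<zero>\<^bsub>R\<^esub>,
      add = ring.indexed_padd R \<rparr>"


section \<open>Forcing equations and forcing algebras\<close>

definition forcing_equation ::
    "('a, 'b) ring_scheme \<Rightarrow> nat \<Rightarrow> (nat \<Rightarrow> 'a) \<Rightarrow> 'a \<Rightarrow> nat multiset \<Rightarrow> 'a" where
  "forcing_equation R n f f\<^sub>0 =
    (let B = poly_ring_in R {1..n} in
      (\<Oplus>\<^bsub>B\<^esub>i\<in>{1..n}. ring.indexed_const R (f i) \<otimes>\<^bsub>B\<^esub> ring.indexed_var R i)
        \<oplus>\<^bsub>B\<^esub> ring.indexed_const R f\<^sub>0)"

definition forcing_algebra ::
    "('a, 'b) ring_scheme \<Rightarrow> nat \<Rightarrow> (nat \<Rightarrow> 'a) \<Rightarrow> 'a \<Rightarrow> (nat multiset \<Rightarrow> 'a) set ring" where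
  "forcing_algebra R n f f\<^sub>0 =
    (let B = poly_ring_in R {1..n} in B Quot (PIdl\<^bsub>B\<^esub> (forcing_equation R n f f\<^sub>0)))"


section \<open>Divisibility\<close>

text \<open>The \<^const>\<open>isgcd\<close> of the library for an arbitrary set of elements.\<close>

definition is_gcd_of :: "('a, 'b) ring_scheme \<Rightarrow> 'a \<Rightarrow> 'a set \<Rightarrow> bool" where
  "is_gcd_of R d S \<longleftrightarrow>
    d \<in> carrier R \<and> (\<forall>a\<in>S. d divides\<^bsub>R\<^esub> a) \<and>
    (\<forall>e\<in>carrier R. (\<forall>a\<in>S. e divides\<^bsub>R\<^esub> a) \<longrightarrow> e divides\<^bsub>R\<^esub> d)"

definition no_common_irreducible_factor :: "('a, 'b) ring_scheme \<Rightarrow> 'a set \<Rightarrow> bool" where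
  "no_common_irreducible_factor R S \<longleftrightarrow>
    \<not> (\<exists>p\<in>carrier R. ring_irreducible\<^bsub>R\<^esub> p \<and> (\<forall>a\<in>S. p divides\<^bsub>R\<^esub> a))"

text \<open>The quotient \<open>a / d\<close>; meaningful in a domain when \<open>d\<close> is nonzero and divides \<open>a\<close>.\<close>

definition exact_quotient :: "('a, 'b) ring_scheme \<Rightarrow> 'a \<Rightarrow> 'a \<Rightarrow> 'a" where
  "exact_quotient R a d = (THE c. c \<in> carrier R \<and> a = d \<otimes>\<^bsub>R\<^esub> c)"


section \<open>The prime spectrum\<close>

definition prime_locus :: "('a, 'b) ring_scheme \<Rightarrow> 'a set \<Rightarrow> 'a set set" where
  "prime_locus R S = {P. primeideal P R \<and> S \<subseteq> P}"

definition zariski_open :: "('a, 'b) ring_scheme \<Rightarrow> 'a set set \<Rightarrow> bool" where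
  "zariski_open R U \<longleftrightarrow> (\<exists>S\<subseteq>carrier R. U = {P. primeideal P R} - prime_locus R S)"

definition Spec :: "('a, 'b) ring_scheme \<Rightarrow> 'a set topology" where
  "Spec R = topology (zariski_open R)"

lemma istopology_zariski_open: "istopology (zariski_open R)"
  unfolding istopology_def
proof (intro conjI allI impI)
  fix U V assume "zariski_open R U" "zariski_open R V"
  then obtain S T where S: "S \<subseteq> carrier R" "U = {P. primeideal P R} - prime_locus R S"
    and T: "T \<subseteq> carrier R" "V = {P. primeideal P R} - prime_locus R T"
    by (auto simp: zariski_open_def)
  define ST where "ST = {s \<otimes>\<^bsub>R\<^esub> t | s t. s \<in> S \<and> t \<in> T}"
  have locus: "ST \<subseteq> P \<longleftrightarrow> S \<subseteq> P \<or> T \<subseteq> P" if P: "primeideal P R" for P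
  proof -
    interpret primeideal P R by (rule P)
    show ?thesis
    proof
      assume "ST \<subseteq> P"
      show "S \<subseteq> P \<or> T \<subseteq> P"
      proof (rule disjCI)
        assume "\<not> T \<subseteq> P"
        then obtain t where t: "t \<in> T" "t \<notin> P" by blast
        have "s \<in> P" if "s \<in> S" for s
        proof -
          have "s \<otimes>\<^bsub>R\<^esub> t \<in> P" using \<open>ST \<subseteq> P\<close> that t(1) by (auto simp: ST_def)
          then show ?thesis using I_prime[of s t] that t S(1) T(1) by blast
        qed
        then show "S \<subseteq> P" by blast
      qed
    next
      assume "S \<subseteq> P \<or> T \<subseteq> P"
      then have "s \<otimes>\<^bsub>R\<^esub> t \<in> P" if "s \<in> S" "t \<in> T" for s t
        using that S(1) T(1) I_l_closed[of t s] I_r_closed[of s t] by blast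
      then show "ST \<subseteq> P" by (auto simp: ST_def)
    qed
  qed
  have "ST \<subseteq> carrier R" if "primeideal P R" for P
  proof -
    interpret primeideal P R by (rule that)
    show ?thesis using S(1) T(1) by (auto simp: ST_def)
  qed
  then show "zariski_open R (U \<inter> V)"
  proof (cases "\<exists>P. primeideal P R")
    case True
    then have "ST \<subseteq> carrier R"
      using \<open>\<And>P. primeideal P R \<Longrightarrow> ST \<subseteq> carrier R\<close> by blast
    moreover have "U \<inter> V = {P. primeideal P R} - prime_locus R ST"
      using locus by (auto simp: S(2) T(2) prime_locus_def)
    ultimately show ?thesis unfolding zariski_open_def by blast
  next
    case False
    then have "U \<inter> V = {P. primeideal P R} - prime_locus R {}"
      by (simp add: S(2))
    then show ?thesis unfolding zariski_open_def by blast
  qed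
next
  fix \<U> assume "\<forall>U\<in>\<U>. zariski_open R U"
  then have "\<forall>U\<in>\<U>. \<exists>S. S \<subseteq> carrier R \<and> U = {P. primeideal P R} - prime_locus R S"
    by (simp add: zariski_open_def)
  then obtain S where S: "\<And>U. U \<in> \<U> \<Longrightarrow>
      S U \<subseteq> carrier R \<and> U = {P. primeideal P R} - prime_locus R (S U)"
    by (auto dest!: bchoice)
  have "P \<in> \<Union>\<U> \<longleftrightarrow> P \<in> {P. primeideal P R} - prime_locus R (\<Union>U\<in>\<U>. S U)" for P
  proof -
    have "P \<in> \<Union>\<U> \<longleftrightarrow> (\<exists>U\<in>\<U>. P \<in> {P. primeideal P R} - prime_locus R (S U))"
      using S by blast
    then show ?thesis by (auto simp: prime_locus_def)
  qed
  then have "\<Union>\<U> = {P. primeideal P R} - prime_locus R (\<Union>U\<in>\<U>. S U)" by blast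
  moreover have "(\<Union>U\<in>\<U>. S U) \<subseteq> carrier R" using S by blast
  ultimately show "zariski_open R (\<Union>\<U>)" unfolding zariski_open_def by blast
qed

lemma openin_Spec: "openin (Spec R) U \<longleftrightarrow> zariski_open R U"
  by (simp add: Spec_def istopology_zariski_open)

lemma topspace_Spec: "topspace (Spec R) = {P. primeideal P R}"
proof -
  have "P \<in> topspace (Spec R)" if P: "primeideal P R" for P
  proof -
    interpret primeideal P R by (rule P)
    have loc: "prime_locus R (carrier R) = {}"
    proof -
      have False if Q: "primeideal Q R" and "carrier R \<subseteq> Q" for Q
      proof -
        interpret Q: primeideal Q R by (rule Q)
        show ?thesis using Q.I_notcarr Q.a_subset \<open>carrier R \<subseteq> Q\<close> by blast
      qed
      then show ?thesis by (auto simp: prime_locus_def)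
    qed
    have "zariski_open R {P. primeideal P R}"
      unfolding zariski_open_def by (intro exI[of _ "carrier R"]) (simp add: loc)
    then show ?thesis using P by (auto simp: topspace_def openin_Spec)
  qed
  then show ?thesis by (auto simp: topspace_def openin_Spec zariski_open_def)
qed

text \<open>\<^const>\<open>connected_space\<close> holds of the empty space, which is excluded here.\<close>

definition nonempty_connected_space :: "'a topology \<Rightarrow> bool" where
  "nonempty_connected_space T \<longleftrightarrow> topspace T \<noteq> {} \<and> connected_space T"

end

theory Submission
  imports Defs "HOL-Library.Multiset_Order"
begin

text \<open>
  Write \<open>f\<^sub>i = d g\<^sub>i\<close> and \<open>f = d g\<close>, so that the forcing equation is \<open>h = d h'\<close> with
  \<open>h' = \<Sum> g\<^sub>i T\<^sub>i + g\<close>, and the coefficients of \<open>h'\<close> have no common irreducible factor. The spectrum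
  of \<open>A = B/(h)\<close> is the closed set \<open>V(h)\<close> of \<open>Spec B\<close>, and it is the union of \<open>V(h')\<close> with the sets
  \<open>V(p)\<close>, where \<open>p\<close> runs through the irreducible factors of \<open>d\<close>. Each of these pieces is irreducible,
  because it is the closure of a point: \<open>pB\<close> is prime since \<open>R/p\<close>, hence \<open>(R/p)[T]\<close>, is a domain,
  and \<open>h'B\<close> is prime since \<open>h'\<close> is primitive and linear (\<open>primitive_forcing_primeideal\<close>).

  The piece \<open>V(p)\<close> meets \<open>V(h')\<close> as soon as \<open>h'\<close> is not a unit modulo \<open>p\<close>, and a polynomial over
  the domain \<open>R/p\<close> with a nonzero linear coefficient is not a unit. This is what the gcd condition
  provides: no irreducible \<open>p\<close> dividing \<open>d\<close> divides all the \<open>g\<^sub>i\<close>. So every piece meets \<open>V(h')\<close>, and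
  the union is connected (\<open>connectedin_prime_locus_forcing\<close>).

  Conversely, let \<open>R\<close> be a principal ideal domain and let an irreducible \<open>p\<close> divide \<open>d\<close> and all the
  \<open>g\<^sub>i\<close>. Modulo \<open>p\<close> the polynomial \<open>h'\<close> is the constant \<open>g\<close>, which is not divisible by \<open>p\<close> and hence a
  unit modulo the maximal ideal \<open>(p)\<close>. So \<open>V(p)\<close> is disjoint from \<open>V(h')\<close>, and also from \<open>V(q)\<close> for
  the irreducible factors \<open>q\<close> of \<open>d\<close> that are not associated to \<open>p\<close>. It is therefore open and closed in \<open>V(h)\<close>, and neither
  it nor its complement is empty (\<open>not_connectedin_prime_locus_forcing\<close>).

  Primality of \<open>pB\<close> and the statement about units both come from comparing leading monomials modulo
  a prime ideal of \<open>R\<close>, for the order on multisets of variables; this order is linear and compatible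
  with the product of monomials. Primality of \<open>h'B\<close> uses a pseudo-division by a variable that occurs
  in \<open>h'\<close>: up to a nonzero constant, each polynomial is congruent modulo \<open>h'\<close> to one that does not
  contain this variable, and the constants can be cancelled modulo \<open>h'\<close> because \<open>h'\<close> lies in no \<open>pB\<close>.
\<close>

section \<open>The ring of polynomials in several variables\<close>

context cring
begin

abbreviation polys :: "'c set \<Rightarrow> ('c multiset \<Rightarrow> 'a) ring" where
  "polys I \<equiv> poly_ring_in R I"

lemma carrier_polys: "carrier (polys I) = indexed_pset I (carrier R)"
  and add_polys: "(P \<oplus>\<^bsub>polys I\<^esub> Q) m = P m \<oplus> Q m"
  and zero_polys: "\<zero>\<^bsub>polys I\<^esub> = indexed_const \<zero>"
  and one_polys: "\<one>\<^bsub>polys I\<^esub> = indexed_const \<one>"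
  and mult_polys: "(P \<otimes>\<^bsub>polys I\<^esub> Q) m = (\<Oplus>k\<in>{k. k \<subseteq># m}. P k \<otimes> Q (m - k))"
  by (simp_all add: poly_ring_in_def indexed_padd_def)

lemma padd_eq_add_polys: "indexed_padd P Q = P \<oplus>\<^bsub>polys I\<^esub> Q"
  by (simp add: poly_ring_in_def)

lemma coeff_closed [simp, intro]: "P \<in> carrier (polys I) \<Longrightarrow> P m \<in> carrier R"
  using indexed_pset_in_carrier[of "carrier R" P I] carrier_coeffE by (auto simp: carrier_polys)

lemma const_closed [simp, intro]: "a \<in> carrier R \<Longrightarrow> indexed_const a \<in> carrier (polys I)"
  by (simp add: carrier_polys indexed_pset.indexed_const)

lemma var_closed [simp, intro]: "i \<in> I \<Longrightarrow> indexed_var i \<in> carrier (polys I)"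
  by (auto simp: carrier_polys indexed_var_def intro!: indexed_pset.intros)

lemma finite_submultisets: "finite {k. k \<subseteq># m}"
proof -
  have "finite {k. set_mset k \<subseteq> set_mset m \<and> size k \<le> size m}"
  proof (rule finite_subset)
    show "{k. set_mset k \<subseteq> set_mset m \<and> size k \<le> size m}
        \<subseteq> mset ` {xs. set xs \<subseteq> set_mset m \<and> length xs \<le> size m}"
    proof
      fix k assume k: "k \<in> {k. set_mset k \<subseteq> set_mset m \<and> size k \<le> size m}"
      obtain xs where "mset xs = k" using ex_mset by blast
      then show "k \<in> mset ` {xs. set xs \<subseteq> set_mset m \<and> length xs \<le> size m}"
        using k by (auto intro!: image_eqI[of _ _ xs] simp flip: size_mset set_mset_mset)
    qed
  qed (simp add: finite_lists_length_le)
  then show ?thesis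
    by (rule rev_finite_subset) (auto dest: mset_subset_eqD size_mset_mono)
qed

lemma const_mult_coeff:
  assumes "a \<in> carrier R" "Q \<in> carrier (polys I)"
  shows "(indexed_const a \<otimes>\<^bsub>polys I\<^esub> Q) m = a \<otimes> Q m"
proof -
  have "(indexed_const a \<otimes>\<^bsub>polys I\<^esub> Q) m
      = (\<Oplus>k\<in>{k. k \<subseteq># m}. if {#} = k then a \<otimes> Q (m - k) else \<zero>)"
    unfolding mult_polys using assms by (intro add.finprod_cong') (auto simp: indexed_const_def)
  also have "\<dots> = a \<otimes> Q m"
    using assms by (subst add.finprod_singleton) (auto simp: finite_submultisets)
  finally show ?thesis .
qed

lemma const_mult_const:
  assumes "a \<in> carrier R" "b \<in> carrier R"
  shows "indexed_const a \<otimes>\<^bsub>polys I\<^esub> indexed_const b = indexed_const (a \<otimes> b)"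
proof
  fix m
  show "(indexed_const a \<otimes>\<^bsub>polys I\<^esub> indexed_const b) m = indexed_const (a \<otimes> b) m"
    using assms by (simp add: const_mult_coeff) (simp add: indexed_const_def)
qed

lemma add_polys_mult:
  assumes "P \<in> carrier (polys I)" "P' \<in> carrier (polys I)" "Q \<in> carrier (polys I)"
  shows "(P \<oplus>\<^bsub>polys I\<^esub> P') \<otimes>\<^bsub>polys I\<^esub> Q = P \<otimes>\<^bsub>polys I\<^esub> Q \<oplus>\<^bsub>polys I\<^esub> P' \<otimes>\<^bsub>polys I\<^esub> Q"
proof
  fix m
  have "((P \<oplus>\<^bsub>polys I\<^esub> P') \<otimes>\<^bsub>polys I\<^esub> Q) m
      = (\<Oplus>k\<in>{k. k \<subseteq># m}. P k \<otimes> Q (m - k) \<oplus> P' k \<otimes> Q (m - k))"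
    unfolding mult_polys using assms
    by (intro add.finprod_cong') (auto simp: add_polys intro!: l_distr)
  then show "((P \<oplus>\<^bsub>polys I\<^esub> P') \<otimes>\<^bsub>polys I\<^esub> Q) m
      = (P \<otimes>\<^bsub>polys I\<^esub> Q \<oplus>\<^bsub>polys I\<^esub> P' \<otimes>\<^bsub>polys I\<^esub> Q) m"
    using assms by (simp add: finsum_addf Pi_iff) (simp add: add_polys mult_polys)
qed

text \<open>The carrier is generated by the constants under addition and multiplication by a variable.
  With the rules for constants and sums proved above, this one turns every statement that is
  additive in the left factor of a product into an induction; in particular associativity needs no
  rearrangement of a double sum.\<close>

lemma pmult_mult:
  assumes "P \<in> carrier (polys I)" "Q \<in> carrier (polys I)"
  shows "indexed_pmult P i \<otimes>\<^bsub>polys I\<^esub> Q = indexed_pmult (P \<otimes>\<^bsub>polys I\<^esub> Q) i"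
proof
  fix m
  show "(indexed_pmult P i \<otimes>\<^bsub>polys I\<^esub> Q) m = indexed_pmult (P \<otimes>\<^bsub>polys I\<^esub> Q) i m"
  proof (cases "i \<in># m")
    case False
    then have "(indexed_pmult P i \<otimes>\<^bsub>polys I\<^esub> Q) m = (\<Oplus>k\<in>{k. k \<subseteq># m}. \<zero>)"
      unfolding mult_polys using assms
      by (intro add.finprod_cong') (auto simp: indexed_pmult_def dest: mset_subset_eqD)
    then show ?thesis using False by (simp add: indexed_pmult_def)
  next
    case True
    let ?f = "\<lambda>k. P (k - {#i#}) \<otimes> Q (m - k)"
    have img: "add_mset i ` {k. k \<subseteq># m - {#i#}} = {k. k \<subseteq># m \<and> i \<in># k}"
    proof (intro subset_antisym subsetI)
      fix k assume "k \<in> {k. k \<subseteq># m \<and> i \<in># k}"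
      then have "k - {#i#} \<subseteq># m - {#i#}" "k = add_mset i (k - {#i#})"
        using insert_subset_eq_iff[of i "k - {#i#}" m] by auto
      then show "k \<in> add_mset i ` {k. k \<subseteq># m - {#i#}}" by blast
    qed (use True in \<open>auto simp: insert_subset_eq_iff\<close>)
    have "(indexed_pmult P i \<otimes>\<^bsub>polys I\<^esub> Q) m = (\<Oplus>k\<in>{k. k \<subseteq># m \<and> i \<in># k}. ?f k)"
      unfolding mult_polys using assms
      by (intro add.finprod_mono_neutral_cong_right)
        (auto simp: finite_submultisets indexed_pmult_def)
    also have "\<dots> = (\<Oplus>k\<in>{k. k \<subseteq># m - {#i#}}. ?f (add_mset i k))"
      unfolding img[symmetric] using assms
      by (intro add.finprod_reindex) (auto simp: inj_on_def)
    also have "\<dots> = indexed_pmult (P \<otimes>\<^bsub>polys I\<^esub> Q) i m"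
      using True assms by (simp add: indexed_pmult_def mult_polys)
    finally show ?thesis .
  qed
qed

lemma polys_induct [consumes 1, case_names const add var]:
  assumes "P \<in> carrier (polys I)"
    and "\<And>a. a \<in> carrier R \<Longrightarrow> S (indexed_const a)"
    and "\<And>P Q. \<lbrakk>P \<in> carrier (polys I); Q \<in> carrier (polys I); S P; S Q\<rbrakk> \<Longrightarrow> S (P \<oplus>\<^bsub>polys I\<^esub> Q)"
    and "\<And>P i. \<lbrakk>P \<in> carrier (polys I); i \<in> I; S P\<rbrakk> \<Longrightarrow> S (indexed_pmult P i)"
  shows "S P"
  using assms(1) unfolding carrier_polys
  by (induction rule: indexed_pset.induct)
    (use assms(2-) in \<open>auto simp: carrier_polys padd_eq_add_polys[of _ _ I]\<close>)

lemma add_polys_closed: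
  "\<lbrakk>P \<in> carrier (polys I); Q \<in> carrier (polys I)\<rbrakk> \<Longrightarrow> P \<oplus>\<^bsub>polys I\<^esub> Q \<in> carrier (polys I)"
  unfolding carrier_polys padd_eq_add_polys[symmetric] by (rule indexed_pset.indexed_padd)

lemma pmult_closed:
  "\<lbrakk>P \<in> carrier (polys I); i \<in> I\<rbrakk> \<Longrightarrow> indexed_pmult P i \<in> carrier (polys I)"
  unfolding carrier_polys by (rule indexed_pset.indexed_pmult)

lemma const_mult_closed:
  assumes "a \<in> carrier R" "Q \<in> carrier (polys I)"
  shows "indexed_const a \<otimes>\<^bsub>polys I\<^esub> Q \<in> carrier (polys I)"
  using assms(2)
proof (induction rule: polys_induct)
  case (const b)
  then show ?case using assms(1) by (simp add: const_mult_const)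
next
  case (add P Q)
  have "indexed_const a \<otimes>\<^bsub>polys I\<^esub> (P \<oplus>\<^bsub>polys I\<^esub> Q)
      = indexed_const a \<otimes>\<^bsub>polys I\<^esub> P \<oplus>\<^bsub>polys I\<^esub> indexed_const a \<otimes>\<^bsub>polys I\<^esub> Q"
    using assms(1) add
    by (auto simp: fun_eq_iff const_mult_coeff add_polys add_polys_closed r_distr)
  then show ?case using add by (simp add: add_polys_closed)
next
  case (var P i)
  have "indexed_const a \<otimes>\<^bsub>polys I\<^esub> indexed_pmult P i
      = indexed_pmult (indexed_const a \<otimes>\<^bsub>polys I\<^esub> P) i"
  proof
    fix m
    show "(indexed_const a \<otimes>\<^bsub>polys I\<^esub> indexed_pmult P i) m
        = indexed_pmult (indexed_const a \<otimes>\<^bsub>polys I\<^esub> P) i m"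
      using assms(1) var
      by (simp add: const_mult_coeff pmult_closed) (simp add: indexed_pmult_def const_mult_coeff)
  qed
  then show ?case using var by (simp add: pmult_closed)
qed

lemma mult_polys_closed:
  assumes "P \<in> carrier (polys I)" "Q \<in> carrier (polys I)"
  shows "P \<otimes>\<^bsub>polys I\<^esub> Q \<in> carrier (polys I)"
  using assms(1)
proof (induction rule: polys_induct)
  case (const a) then show ?case using assms by (simp add: const_mult_closed)
next
  case (add P P') then show ?case using assms by (simp add: add_polys_mult add_polys_closed)
next
  case (var P i) then show ?case using assms by (simp add: pmult_mult pmult_closed)
qed

text \<open>The involution \<open>k \<mapsto> m - k\<close> of the divisors of \<open>m\<close> exchanges the two factors of each summand.\<close>

lemma mult_polys_comm:
  assumes "P \<in> carrier (polys I)" "Q \<in> carrier (polys I)"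
  shows "P \<otimes>\<^bsub>polys I\<^esub> Q = Q \<otimes>\<^bsub>polys I\<^esub> P"
proof
  fix m :: "'c multiset"
  have diff_diff: "m - (m - k) = k" if "k \<subseteq># m" for k
    using that by (simp add: multiset_eq_iff subseteq_mset_def)
  have img: "(\<lambda>k. m - k) ` {k. k \<subseteq># m} = {k. k \<subseteq># m}"
  proof (intro subset_antisym subsetI)
    fix k assume "k \<in> {k. k \<subseteq># m}"
    then show "k \<in> (\<lambda>k. m - k) ` {k. k \<subseteq># m}" by (intro image_eqI[of _ _ "m - k"]) (auto simp: diff_diff)
  qed auto
  have "inj_on (\<lambda>k. m - k) {k. k \<subseteq># m}"
    by (rule inj_on_inverseI[where g = "\<lambda>k. m - k"]) (simp add: diff_diff)
  then have "(\<Oplus>k\<in>{k. k \<subseteq># m}. P k \<otimes> Q (m - k))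
      = (\<Oplus>k\<in>{k. k \<subseteq># m}. P (m - k) \<otimes> Q (m - (m - k)))"
    using assms by (subst img[symmetric], subst add.finprod_reindex) (auto simp: img)
  also have "\<dots> = (\<Oplus>k\<in>{k. k \<subseteq># m}. Q k \<otimes> P (m - k))"
    using assms by (intro add.finprod_cong') (auto simp: m_comm diff_diff)
  finally show "(P \<otimes>\<^bsub>polys I\<^esub> Q) m = (Q \<otimes>\<^bsub>polys I\<^esub> P) m"
    by (simp add: mult_polys)
qed

lemma mult_polys_assoc:
  assumes "P \<in> carrier (polys I)" "Q \<in> carrier (polys I)" "S \<in> carrier (polys I)"
  shows "(P \<otimes>\<^bsub>polys I\<^esub> Q) \<otimes>\<^bsub>polys I\<^esub> S = P \<otimes>\<^bsub>polys I\<^esub> (Q \<otimes>\<^bsub>polys I\<^esub> S)"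
  using assms(1)
proof (induction rule: polys_induct)
  case (const a)
  show ?case
  proof
    fix m
    have "((indexed_const a \<otimes>\<^bsub>polys I\<^esub> Q) \<otimes>\<^bsub>polys I\<^esub> S) m
        = (\<Oplus>k\<in>{k. k \<subseteq># m}. a \<otimes> (Q k \<otimes> S (m - k)))"
      using const assms
      by (subst mult_polys, intro add.finprod_cong') (auto simp: const_mult_coeff m_assoc)
    also have "\<dots> = a \<otimes> (Q \<otimes>\<^bsub>polys I\<^esub> S) m"
      using const assms
      by (simp add: mult_polys finsum_rdistr[OF finite_submultisets] Pi_iff)
    also have "\<dots> = (indexed_const a \<otimes>\<^bsub>polys I\<^esub> (Q \<otimes>\<^bsub>polys I\<^esub> S)) m"
      using const assms by (simp add: const_mult_coeff mult_polys_closed)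
    finally show "((indexed_const a \<otimes>\<^bsub>polys I\<^esub> Q) \<otimes>\<^bsub>polys I\<^esub> S) m
        = (indexed_const a \<otimes>\<^bsub>polys I\<^esub> (Q \<otimes>\<^bsub>polys I\<^esub> S)) m" .
  qed
next
  case (add P P') then show ?case using assms by (simp add: add_polys_mult mult_polys_closed)
next
  case (var P i)
  then show ?case using assms by (simp add: pmult_mult mult_polys_closed pmult_closed)
qed

theorem polys_cring: "cring (polys I)"
proof (rule cringI)
  show "abelian_group (polys I)"
  proof (rule abelian_groupI)
    fix P assume P: "P \<in> carrier (polys I)"
    have "indexed_const (\<ominus> \<one>) \<otimes>\<^bsub>polys I\<^esub> P \<oplus>\<^bsub>polys I\<^esub> P = \<zero>\<^bsub>polys I\<^esub>"
    proof
      fix m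
      have "P m \<in> carrier R" using P by blast
      then show "(indexed_const (\<ominus> \<one>) \<otimes>\<^bsub>polys I\<^esub> P \<oplus>\<^bsub>polys I\<^esub> P) m = \<zero>\<^bsub>polys I\<^esub> m"
        using P by (simp add: add_polys const_mult_coeff zero_polys indexed_zero_def l_minus l_neg)
    qed
    then show "\<exists>Q\<in>carrier (polys I). Q \<oplus>\<^bsub>polys I\<^esub> P = \<zero>\<^bsub>polys I\<^esub>"
      using P by (intro bexI[of _ "indexed_const (\<ominus> \<one>) \<otimes>\<^bsub>polys I\<^esub> P"] const_mult_closed) auto
  next
    show "\<zero>\<^bsub>polys I\<^esub> \<in> carrier (polys I)" by (auto simp: zero_polys)
  qed (auto simp: add_polys_closed fun_eq_iff add_polys zero_polys indexed_zero_def a_ac)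
  show "Group.comm_monoid (polys I)"
  proof (rule comm_monoidI)
    show "\<one>\<^bsub>polys I\<^esub> \<otimes>\<^bsub>polys I\<^esub> P = P" if "P \<in> carrier (polys I)" for P
      using that by (auto simp: one_polys fun_eq_iff const_mult_coeff)
  qed (auto simp: mult_polys_closed mult_polys_assoc one_polys intro: mult_polys_comm)
qed (rule add_polys_mult)

text \<open>It lets the generating operation of the carrier enter computations in the ring.\<close>

lemma pmult_eq_mult_var:
  assumes "P \<in> carrier (polys I)"
  shows "indexed_pmult P i = indexed_var i \<otimes>\<^bsub>polys I\<^esub> P"
proof -
  interpret B: cring "polys I" by (rule polys_cring)
  have "indexed_pmult (indexed_const \<one>) i \<otimes>\<^bsub>polys I\<^esub> P
      = indexed_pmult (indexed_const \<one> \<otimes>\<^bsub>polys I\<^esub> P) i"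
    using assms by (intro pmult_mult) auto
  then show ?thesis
    using assms by (simp add: indexed_var_def one_polys[symmetric, of I])
qed

lemma mult_const_coeff:
  assumes "a \<in> carrier R" "Q \<in> carrier (polys I)"
  shows "(Q \<otimes>\<^bsub>polys I\<^esub> indexed_const a) m = Q m \<otimes> a"
proof -
  have "Q \<otimes>\<^bsub>polys I\<^esub> indexed_const a = indexed_const a \<otimes>\<^bsub>polys I\<^esub> Q"
    using assms by (intro mult_polys_comm) auto
  then show ?thesis using assms by (simp add: const_mult_coeff m_comm coeff_closed)
qed

lemma const_ring_hom: "ring_hom_ring R (polys I) indexed_const"
proof (rule ring_hom_ringI)
  show "indexed_const (a \<oplus> b) = indexed_const a \<oplus>\<^bsub>polys I\<^esub> indexed_const b" for a b
    by (simp add: indexed_padd_const[symmetric] padd_eq_add_polys[of _ _ I])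
qed (auto simp: cring.axioms(1)[OF polys_cring] ring_axioms const_mult_const one_polys)

lemma polys_zero_coeff: "\<zero>\<^bsub>polys I\<^esub> m = \<zero>"
  by (simp add: zero_polys indexed_zero_def)

lemma polys_uminus_coeff:
  assumes "P \<in> carrier (polys I)"
  shows "(\<ominus>\<^bsub>polys I\<^esub> P) m = \<ominus> P m"
proof -
  interpret B: cring "polys I" by (rule polys_cring)
  have "(\<ominus>\<^bsub>polys I\<^esub> P) m \<oplus> P m = \<zero>"
    using assms by (simp add: add_polys[symmetric, where I = I] B.l_neg polys_zero_coeff)
  then show ?thesis using assms B.a_inv_closed[OF assms] by (metis minus_equality coeff_closed)
qed

lemma monom_in_polys:
  assumes "a \<in> carrier R" "set_mset m \<subseteq> I"
  shows "(\<lambda>k. if k = m then a else \<zero>) \<in> carrier (polys I)"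
  using assms(2)
proof (induction m)
  case empty
  have "(\<lambda>k. if k = {#} then a else \<zero>) = indexed_const a" by (simp add: indexed_const_def)
  then show ?case using assms(1) const_closed by metis
next
  case (add i m)
  have "(\<lambda>k. if k = add_mset i m then a else \<zero>) = indexed_pmult (\<lambda>k. if k = m then a else \<zero>) i"
    by (auto simp: fun_eq_iff indexed_pmult_def)
  then show ?case using add by (simp add: pmult_closed)
qed

text \<open>The carrier is described by generators; this is the description by coefficients.\<close>

lemma polys_carrier_iff:
  "P \<in> carrier (polys I) \<longleftrightarrow>
     finite {m. P m \<noteq> \<zero>} \<and> (\<forall>m. P m \<in> carrier R) \<and> (\<forall>m. P m \<noteq> \<zero> \<longrightarrow> set_mset m \<subseteq> I)"
proof
  assume P: "P \<in> carrier (polys I)"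
  then have "finite {m. P m \<noteq> \<zero>} \<and> (\<forall>m. P m \<noteq> \<zero> \<longrightarrow> set_mset m \<subseteq> I)"
  proof (induction rule: polys_induct)
    case (const a) then show ?case
      by (auto simp: indexed_const_def intro: finite_subset[of _ "{{#}}"])
  next
    case (add P Q)
    have "{m. (P \<oplus>\<^bsub>polys I\<^esub> Q) m \<noteq> \<zero>} \<subseteq> {m. P m \<noteq> \<zero>} \<union> {m. Q m \<noteq> \<zero>}"
      by (auto simp: add_polys)
    moreover have "set_mset m \<subseteq> I" if "(P \<oplus>\<^bsub>polys I\<^esub> Q) m \<noteq> \<zero>" for m
    proof -
      have "P m \<noteq> \<zero> \<or> Q m \<noteq> \<zero>" using that by (auto simp: add_polys)
      then show ?thesis using add.IH by blast
    qed
    moreover have "finite ({m. P m \<noteq> \<zero>} \<union> {m. Q m \<noteq> \<zero>})" using add.IH by simp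
    ultimately show ?case using finite_subset by blast
  next
    case (var P i)
    have sub: "{m. indexed_pmult P i m \<noteq> \<zero>} \<subseteq> add_mset i ` {m. P m \<noteq> \<zero>}"
    proof
      fix m assume "m \<in> {m. indexed_pmult P i m \<noteq> \<zero>}"
      then have "i \<in># m" "P (m - {#i#}) \<noteq> \<zero>"
        by (auto simp: indexed_pmult_def split: if_splits)
      then show "m \<in> add_mset i ` {m. P m \<noteq> \<zero>}" by (intro image_eqI[of _ _ "m - {#i#}"]) auto
    qed
    have "finite {m. indexed_pmult P i m \<noteq> \<zero>}"
      using var.IH by (intro finite_subset[OF sub] finite_imageI) blast
    moreover have "set_mset m \<subseteq> I" if m: "indexed_pmult P i m \<noteq> \<zero>" for m
    proof -
      obtain k where "m = add_mset i k" "P k \<noteq> \<zero>" using sub m by blast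
      then show ?thesis using var by auto
    qed
    ultimately show ?case by blast
  qed
  then show "finite {m. P m \<noteq> \<zero>} \<and> (\<forall>m. P m \<in> carrier R) \<and> (\<forall>m. P m \<noteq> \<zero> \<longrightarrow> set_mset m \<subseteq> I)"
    using P by blast
next
  assume "finite {m. P m \<noteq> \<zero>} \<and> (\<forall>m. P m \<in> carrier R) \<and> (\<forall>m. P m \<noteq> \<zero> \<longrightarrow> set_mset m \<subseteq> I)"
  moreover have "P \<in> carrier (polys I)"
    if "finite A" "{m. P m \<noteq> \<zero>} = A" "\<forall>m. P m \<in> carrier R" "\<forall>m. P m \<noteq> \<zero> \<longrightarrow> set_mset m \<subseteq> I"
    for A P
    using that
  proof (induction A arbitrary: P)
    case empty
    then have "P = indexed_const \<zero>" by (auto simp: indexed_zero_def)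
    then show ?case by auto
  next
    case (insert m A)
    have "P(m := \<zero>) \<in> carrier (polys I)" using insert.prems insert.hyps by (intro insert.IH) auto
    moreover have "(\<lambda>k. if k = m then P m else \<zero>) \<in> carrier (polys I)"
      using insert.prems by (intro monom_in_polys) auto
    moreover have "P = P(m := \<zero>) \<oplus>\<^bsub>polys I\<^esub> (\<lambda>k. if k = m then P m else \<zero>)"
      using insert.prems by (auto simp: fun_eq_iff add_polys)
    ultimately show ?case by (metis add_polys_closed)
  qed
  ultimately show "P \<in> carrier (polys I)" by blast
qed

end


section \<open>Leading monomials modulo an ideal of the coefficient ring\<close>

context cring
begin

text \<open>The leading monomial of the image of \<open>P\<close> in \<open>(R/\<pp>)[T]\<close>, expressed without forming the
  quotient. Monomials are compared by the order on multisets over a linear order.\<close>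

definition is_leading_mod :: "'a set \<Rightarrow> ('c::linorder multiset \<Rightarrow> 'a) \<Rightarrow> 'c multiset \<Rightarrow> bool" where
  "is_leading_mod \<pp> P m \<longleftrightarrow> P m \<notin> \<pp> \<and> (\<forall>k>m. P k \<in> \<pp>)"

text \<open>The extension \<open>\<pp>B\<close> of \<open>\<pp>\<close> to the polynomial ring, that is, the kernel of reduction modulo \<open>\<pp>\<close>.\<close>

definition coeffs_in :: "'a set \<Rightarrow> 'c set \<Rightarrow> ('c multiset \<Rightarrow> 'a) set" where
  "coeffs_in \<pp> I = {P \<in> carrier (polys I). \<forall>m. P m \<in> \<pp>}"

lemma ex_leading_mod:
  assumes "ideal \<pp> R" "P \<in> carrier (polys I)" "P \<notin> coeffs_in \<pp> I"
  obtains m where "is_leading_mod \<pp> P m"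
proof -
  interpret \<pp>: ideal \<pp> R by fact
  let ?A = "{m. P m \<notin> \<pp>}"
  have "?A \<subseteq> {m. P m \<noteq> \<zero>}" using \<pp>.zero_closed by auto
  then have fin: "finite ?A"
    using assms(2) by (metis polys_carrier_iff finite_subset)
  have "?A \<noteq> {}" using assms(2,3) by (auto simp: coeffs_in_def)
  with fin have "Max ?A \<in> ?A" by (rule Max_in)
  moreover have "P k \<in> \<pp>" if "k > Max ?A" for k
  proof (rule ccontr)
    assume "P k \<notin> \<pp>"
    then have "k \<le> Max ?A" using fin by (intro Max_ge) auto
    with that show False by simp
  qed
  ultimately have "is_leading_mod \<pp> P (Max ?A)" unfolding is_leading_mod_def by blast
  then show ?thesis by (rule that)
qed

lemma finsum_in_ideal:
  assumes "ideal \<pp> R" "\<And>x. x \<in> A \<Longrightarrow> g x \<in> \<pp>"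
  shows "(\<Oplus>x\<in>A. g x) \<in> \<pp>"
proof -
  interpret \<pp>: ideal \<pp> R by fact
  show ?thesis using assms(2)
    by (induction A rule: infinite_finite_induct) (auto simp: Pi_iff finsum_infinite)
qed

lemma ideal_add_cancel:
  assumes "ideal J R" "x \<oplus> y \<in> J" "y \<in> J" "x \<in> carrier R"
  shows "x \<in> J"
proof -
  interpret J: ideal J R by fact
  have "x = (x \<oplus> y) \<oplus> \<ominus> y" using assms(3,4) J.Icarr by (simp add: a_assoc r_neg)
  then show ?thesis using assms(2,3) by (metis J.a_closed J.a_inv_closed)
qed

text \<open>Leading monomials multiply. In the coefficient at \<open>k + l\<close>, a summand belonging to a
  factorisation other than \<open>k + l\<close> itself has a factor beyond a leading monomial, so it lies
  in \<open>\<pp>\<close>; the remaining summand is a product of two elements outside \<open>\<pp>\<close>.\<close>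

lemma leading_mod_mult:
  assumes "primeideal \<pp> R" "P \<in> carrier (polys I)" "Q \<in> carrier (polys I)"
    and "is_leading_mod \<pp> P k" "is_leading_mod \<pp> Q l"
  shows "(P \<otimes>\<^bsub>polys I\<^esub> Q) (k + l) \<notin> \<pp>"
proof
  interpret \<pp>: primeideal \<pp> R by fact
  let ?S = "{j. j \<subseteq># k + l}" let ?t = "\<lambda>j. P j \<otimes> Q (k + l - j)"
  have other: "?t j \<in> \<pp>" if "j \<subseteq># k + l" "j \<noteq> k" for j
  proof (cases "j > k")
    case True
    then show ?thesis
      using assms by (auto simp: is_leading_mod_def intro: \<pp>.I_r_closed)
  next
    case False
    then have "j < k" using that(2) by simp
    moreover have "j + (k + l - j) = k + l" using that(1) by simp
    ultimately have "k + l - j > l"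
      by (metis add_less_cancel_left add_strict_right_mono)
    then show ?thesis
      using assms by (auto simp: is_leading_mod_def intro: \<pp>.I_l_closed)
  qed
  assume "(P \<otimes>\<^bsub>polys I\<^esub> Q) (k + l) \<in> \<pp>"
  moreover have "(P \<otimes>\<^bsub>polys I\<^esub> Q) (k + l) = (\<Oplus>j\<in>insert k (?S - {k}). ?t j)"
    by (simp add: mult_polys insert_absorb)
  moreover have "\<dots> = P k \<otimes> Q l \<oplus> (\<Oplus>j\<in>?S - {k}. ?t j)"
    using assms by (subst finsum_insert) (auto simp: finite_submultisets)
  moreover have rest: "(\<Oplus>j\<in>?S - {k}. ?t j) \<in> \<pp>"
    using other by (intro finsum_in_ideal \<pp>.ideal_axioms) auto
  ultimately have sum: "P k \<otimes> Q l \<oplus> (\<Oplus>j\<in>?S - {k}. ?t j) \<in> \<pp>" by simp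
  have carr: "P k \<in> carrier R" "Q l \<in> carrier R" using assms by auto
  then have "P k \<otimes> Q l \<in> \<pp>" using ideal_add_cancel[OF \<pp>.ideal_axioms sum rest] by simp
  then show False
    using \<pp>.I_prime[OF carr] assms(4,5) by (auto simp: is_leading_mod_def)
qed

lemma coeffs_in_ideal:
  assumes "ideal \<pp> R"
  shows "ideal (coeffs_in \<pp> I) (polys I)"
proof -
  interpret \<pp>: ideal \<pp> R by fact
  interpret B: cring "polys I" by (rule polys_cring)
  have l: "Q \<otimes>\<^bsub>polys I\<^esub> P \<in> coeffs_in \<pp> I"
    if "P \<in> coeffs_in \<pp> I" "Q \<in> carrier (polys I)" for P Q
  proof -
    have "Q k \<otimes> P (m - k) \<in> \<pp>" for k m
      using that by (intro \<pp>.I_l_closed) (simp_all add: coeffs_in_def coeff_closed)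
    then have "(Q \<otimes>\<^bsub>polys I\<^esub> P) m \<in> \<pp>" for m
      unfolding mult_polys by (intro finsum_in_ideal assms)
    then show ?thesis using that by (simp add: coeffs_in_def)
  qed
  show ?thesis
  proof (rule idealI)
    show "ring (polys I)" by (rule B.ring_axioms)
    show "subgroup (coeffs_in \<pp> I) (add_monoid (polys I))"
    proof (rule B.add.subgroupI)
      have "\<zero>\<^bsub>polys I\<^esub> \<in> coeffs_in \<pp> I"
        using B.zero_closed \<pp>.zero_closed by (simp add: coeffs_in_def polys_zero_coeff)
      then show "coeffs_in \<pp> I \<noteq> {}" by blast
      show "coeffs_in \<pp> I \<subseteq> carrier (polys I)" unfolding coeffs_in_def by blast
      fix P Q assume PQ: "P \<in> coeffs_in \<pp> I" "Q \<in> coeffs_in \<pp> I"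
      then show "\<ominus>\<^bsub>polys I\<^esub> P \<in> coeffs_in \<pp> I"
        by (simp add: coeffs_in_def polys_uminus_coeff)
      show "P \<oplus>\<^bsub>polys I\<^esub> Q \<in> coeffs_in \<pp> I"
        using PQ by (simp add: coeffs_in_def add_polys)
    qed
    show "Q \<otimes>\<^bsub>polys I\<^esub> P \<in> coeffs_in \<pp> I"
      if "P \<in> coeffs_in \<pp> I" "Q \<in> carrier (polys I)" for P Q using that by (rule l)
    show "P \<otimes>\<^bsub>polys I\<^esub> Q \<in> coeffs_in \<pp> I"
      if "P \<in> coeffs_in \<pp> I" "Q \<in> carrier (polys I)" for P Q
      using l[OF that] that B.m_comm[of P Q] by (simp add: coeffs_in_def)
  qed
qed

text \<open>The familiar fact that \<open>(R/\<pp>)[T]\<close> is a domain.\<close>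

theorem coeffs_in_primeideal:
  fixes I :: "'c::linorder set"
  assumes "primeideal \<pp> R"
  shows "primeideal (coeffs_in \<pp> I) (polys I)"
proof -
  interpret \<pp>: primeideal \<pp> R by fact
  show ?thesis
  proof (rule primeidealI)
    show "ideal (coeffs_in \<pp> I) (polys I)"
      by (rule coeffs_in_ideal) (rule \<pp>.ideal_axioms)
    show "cring (polys I)" by (rule polys_cring)
    have "\<one> \<notin> \<pp>" using \<pp>.one_imp_carrier \<pp>.I_notcarr by blast
    moreover have "indexed_const \<one> {#} = \<one>" by (simp add: indexed_const_def)
    ultimately have "indexed_const \<one> \<notin> coeffs_in \<pp> I"
      unfolding coeffs_in_def by (metis (mono_tags, lifting) mem_Collect_eq)
    then show "carrier (polys I) \<noteq> coeffs_in \<pp> I" using const_closed[OF one_closed] by blast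
  next
    fix P Q :: "'c multiset \<Rightarrow> 'a"
    assume PQ: "P \<in> carrier (polys I)" "Q \<in> carrier (polys I)"
      and prod: "P \<otimes>\<^bsub>polys I\<^esub> Q \<in> coeffs_in \<pp> I"
    show "P \<in> coeffs_in \<pp> I \<or> Q \<in> coeffs_in \<pp> I"
    proof (rule ccontr)
      assume "\<not> ?thesis"
      then obtain k l where "is_leading_mod \<pp> P k" "is_leading_mod \<pp> Q l"
        using PQ ex_leading_mod[OF \<pp>.ideal_axioms] by metis
      then show False
        using leading_mod_mult[OF assms PQ] prod unfolding coeffs_in_def by blast
    qed
  qed
qed

lemma coeffs_in_zero: "coeffs_in {\<zero>} I = {\<zero>\<^bsub>polys I\<^esub>}"
proof -
  interpret B: cring "polys I" by (rule polys_cring)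
  have "P = \<zero>\<^bsub>polys I\<^esub>" if "P \<in> coeffs_in {\<zero>} I" for P
    using that by (intro ext) (simp add: coeffs_in_def polys_zero_coeff)
  moreover have "\<zero>\<^bsub>polys I\<^esub> \<in> coeffs_in {\<zero>} I"
    using B.zero_closed by (simp add: coeffs_in_def polys_zero_coeff)
  ultimately show ?thesis by blast
qed

text \<open>A polynomial with coefficients in \<open>(p)\<close> can be divided by \<open>p\<close> coefficientwise.\<close>

lemma coeffs_in_PIdl:
  assumes "p \<in> carrier R"
  shows "coeffs_in (PIdl p) I = PIdl\<^bsub>polys I\<^esub> (indexed_const p)"
proof -
  interpret B: cring "polys I" by (rule polys_cring)
  show ?thesis
  proof (intro subset_antisym subsetI)
    fix P assume P: "P \<in> coeffs_in (PIdl p) I"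
    then have "P m \<in> PIdl p" for m by (simp add: coeffs_in_def)
    then have "\<exists>c. c \<in> carrier R \<and> P m = c \<otimes> p" for m
      unfolding cgenideal_def by blast
    then obtain c where c: "\<And>m. c m \<in> carrier R" "\<And>m. P m = c m \<otimes> p" by metis
    \<comment> \<open>When \<open>p\<close> is a zero divisor, \<open>c\<close> may be nonzero at infinitely many zeros of \<open>P\<close>; the support of \<open>Q\<close> is finite.\<close>
    define Q where "Q = (\<lambda>m. if P m = \<zero> then \<zero> else c m)"
    have "{m. Q m \<noteq> \<zero>} \<subseteq> {m. P m \<noteq> \<zero>}" by (auto simp: Q_def)
    moreover have "P \<in> carrier (polys I)" using P by (simp add: coeffs_in_def)
    ultimately have Q: "Q \<in> carrier (polys I)"
      unfolding polys_carrier_iff using c(1)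
      by (metis (no_types, lifting) Q_def finite_subset zero_closed)
    moreover have "P = Q \<otimes>\<^bsub>polys I\<^esub> indexed_const p"
    proof
      fix m
      show "P m = (Q \<otimes>\<^bsub>polys I\<^esub> indexed_const p) m"
        using assms Q c[of m] by (simp add: mult_const_coeff) (simp add: Q_def)
    qed
    ultimately show "P \<in> PIdl\<^bsub>polys I\<^esub> (indexed_const p)" unfolding cgenideal_def by blast
  next
    fix P assume "P \<in> PIdl\<^bsub>polys I\<^esub> (indexed_const p)"
    then obtain Q where Q: "Q \<in> carrier (polys I)" "P = Q \<otimes>\<^bsub>polys I\<^esub> indexed_const p"
      by (auto simp: cgenideal_def)
    then have "P m = Q m \<otimes> p" for m
      using assms by (simp add: mult_const_coeff)
    moreover have "P \<in> carrier (polys I)" using Q assms by auto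
    moreover have "Q m \<otimes> p \<in> PIdl p" for m
      unfolding cgenideal_def using Q(1) by blast
    ultimately show "P \<in> coeffs_in (PIdl p) I" by (simp add: coeffs_in_def)
  qed
qed

end

lemma (in domain) polys_domain: "domain (polys (I :: 'c::linorder set))"
proof -
  interpret B: cring "polys I" by (rule polys_cring)
  show ?thesis
    using coeffs_in_primeideal[OF zeroprimeideal, of I]
    by (intro B.zeroprimeideal_domainI) (simp add: coeffs_in_zero)
qed


section \<open>Forcing equations\<close>

context cring
begin

lemma finsum_polys_coeff:
  assumes "finite A" "g \<in> A \<rightarrow> carrier (polys I)"
  shows "(\<Oplus>\<^bsub>polys I\<^esub>i\<in>A. g i) m = (\<Oplus>i\<in>A. g i m)"
  using assms
proof (induction A rule: finite_induct)
  case empty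
  interpret B: cring "polys I" by (rule polys_cring)
  show ?case by (simp add: polys_zero_coeff)
next
  case (insert x A)
  interpret B: cring "polys I" by (rule polys_cring)
  have "(\<lambda>i. g i m) \<in> A \<rightarrow> carrier R" "g x m \<in> carrier R"
    using insert.prems by (auto intro: coeff_closed)
  then show ?case using insert by (simp add: add_polys)
qed

lemma var_coeff: "indexed_var i m = (if m = {#i#} then \<one> else \<zero>)"
proof -
  have "m - {#i#} = {#} \<longleftrightarrow> m = {#i#}" if "i \<in># m"
    using that by (metis insert_DiffM add_mset_remove_trivial)
  then show ?thesis by (auto simp: indexed_var_def indexed_pmult_def indexed_const_def)
qed

lemma const_mult_var_coeff:
  assumes "a \<in> carrier R" "i \<in> I"
  shows "(indexed_const a \<otimes>\<^bsub>polys I\<^esub> indexed_var i) m = (if m = {#i#} then a else \<zero>)"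
  using assms by (simp add: const_mult_coeff var_closed var_coeff)

context
  fixes I :: "nat set" and n :: nat and f :: "nat \<Rightarrow> 'a" and f\<^sub>0 :: 'a
  assumes I: "I = {1..n}" and f: "\<And>i. i \<in> I \<Longrightarrow> f i \<in> carrier R" and f\<^sub>0: "f\<^sub>0 \<in> carrier R"
begin

lemma finite_I: "finite I"
  by (simp add: I)

lemma forcing_closed [simp, intro]: "forcing_equation R n f f\<^sub>0 \<in> carrier (polys I)"
proof -
  interpret B: cring "polys I" by (rule polys_cring)
  have "(\<Oplus>\<^bsub>polys I\<^esub>i\<in>I. indexed_const (f i) \<otimes>\<^bsub>polys I\<^esub> indexed_var i)
      \<in> carrier (polys I)"
    using f by (intro B.finsum_closed) (auto intro!: B.m_closed const_closed var_closed)
  then show ?thesis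
    using f\<^sub>0 unfolding forcing_equation_def Let_def I[symmetric] by (simp add: const_closed)
qed

lemma forcing_coeff:
  "forcing_equation R n f f\<^sub>0 m
    = (\<Oplus>i\<in>I. if m = {#i#} then f i else \<zero>) \<oplus> (if m = {#} then f\<^sub>0 else \<zero>)"
proof -
  interpret B: cring "polys I" by (rule polys_cring)
  have "(\<lambda>i. indexed_const (f i) \<otimes>\<^bsub>polys I\<^esub> indexed_var i)
      \<in> I \<rightarrow> carrier (polys I)"
    using f by (auto intro!: B.m_closed const_closed var_closed)
  then have "forcing_equation R n f f\<^sub>0 m
      = (\<Oplus>i\<in>I. (indexed_const (f i) \<otimes>\<^bsub>polys I\<^esub> indexed_var i) m) \<oplus> indexed_const f\<^sub>0 m"
    unfolding forcing_equation_def Let_def I[symmetric]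
    by (simp add: add_polys finsum_polys_coeff finite_I)
  also have "(\<Oplus>i\<in>I. (indexed_const (f i) \<otimes>\<^bsub>polys I\<^esub> indexed_var i) m)
      = (\<Oplus>i\<in>I. if m = {#i#} then f i else \<zero>)"
    using f by (intro add.finprod_cong') (simp_all add: const_mult_var_coeff)
  finally show ?thesis by (simp add: indexed_const_def)
qed

lemma forcing_coeff_empty: "forcing_equation R n f f\<^sub>0 {#} = f\<^sub>0"
  using f\<^sub>0 by (simp add: forcing_coeff)

lemma forcing_coeff_single:
  assumes "i \<in> I"
  shows "forcing_equation R n f f\<^sub>0 {#i#} = f i"
proof -
  have "(\<Oplus>k\<in>I. if {#i#} = {#k#} then f k else \<zero>) = (\<Oplus>k\<in>I. if i = k then f k else \<zero>)"
    using f by (intro add.finprod_cong') auto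
  also have "\<dots> = f i" using assms f finite_I by (intro add.finprod_singleton) auto
  finally show ?thesis using assms f by (simp add: forcing_coeff)
qed

lemma forcing_coeff_other:
  assumes "m \<noteq> {#}" "\<And>i. i \<in> I \<Longrightarrow> m \<noteq> {#i#}"
  shows "forcing_equation R n f f\<^sub>0 m = \<zero>"
proof -
  have "(\<Oplus>i\<in>I. if m = {#i#} then f i else \<zero>) = (\<Oplus>i\<in>I. \<zero>)"
    using assms(2) by (intro add.finprod_cong') auto
  then show ?thesis using assms(1) by (simp add: forcing_coeff)
qed

lemma forcing_eqI:
  assumes "P {#} = f\<^sub>0" "\<And>i. i \<in> I \<Longrightarrow> P {#i#} = f i"
    and "\<And>m. \<lbrakk>m \<noteq> {#}; \<And>i. i \<in> I \<Longrightarrow> m \<noteq> {#i#}\<rbrakk> \<Longrightarrow> P m = \<zero>"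
  shows "P = forcing_equation R n f f\<^sub>0"
proof
  fix m :: "nat multiset"
  consider "m = {#}" | i where "i \<in> I" "m = {#i#}"
    | "m \<noteq> {#}" "\<And>i. i \<in> I \<Longrightarrow> m \<noteq> {#i#}" by blast
  then show "P m = forcing_equation R n f f\<^sub>0 m"
    by cases
      (simp_all add: assms forcing_coeff_empty forcing_coeff_single forcing_coeff_other)
qed

lemma forcing_scale:
  assumes "d \<in> carrier R"
  shows "indexed_const d \<otimes>\<^bsub>polys I\<^esub> forcing_equation R n f f\<^sub>0
    = forcing_equation R n (\<lambda>i. d \<otimes> f i) (d \<otimes> f\<^sub>0)"
proof -
  have c: "(indexed_const d \<otimes>\<^bsub>polys I\<^esub> forcing_equation R n f f\<^sub>0) m
      = d \<otimes> forcing_equation R n f f\<^sub>0 m" for m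
    using assms by (simp add: const_mult_coeff forcing_closed)
  show ?thesis
    using assms f f\<^sub>0
    by (intro cring.forcing_eqI[OF is_cring I])
      (simp_all add: c forcing_coeff_empty forcing_coeff_single forcing_coeff_other)
qed

lemma forcing_in_coeffs_in_iff:
  assumes "ideal \<pp> R"
  shows "forcing_equation R n f f\<^sub>0 \<in> coeffs_in \<pp> I \<longleftrightarrow> f\<^sub>0 \<in> \<pp> \<and> (\<forall>i\<in>I. f i \<in> \<pp>)"
proof -
  interpret \<pp>: ideal \<pp> R by fact
  have "(\<forall>m. forcing_equation R n f f\<^sub>0 m \<in> \<pp>) \<longleftrightarrow> f\<^sub>0 \<in> \<pp> \<and> (\<forall>i\<in>I. f i \<in> \<pp>)"
    using \<pp>.zero_closed
    by (metis forcing_coeff_empty forcing_coeff_single forcing_coeff_other)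
  then show ?thesis by (simp add: coeffs_in_def forcing_closed)
qed

text \<open>A nonzero linear coefficient makes the leading monomial a variable, since the empty monomial
  is the smallest one.\<close>

lemma forcing_leading_mod:
  assumes "ideal \<pp> R" "i \<in> I" "f i \<notin> \<pp>"
  obtains j where "j \<in> I" "f j \<notin> \<pp>" "is_leading_mod \<pp> (forcing_equation R n f f\<^sub>0) {#j#}"
proof -
  interpret \<pp>: ideal \<pp> R by fact
  have "forcing_equation R n f f\<^sub>0 \<notin> coeffs_in \<pp> I"
    using assms by (auto simp: forcing_in_coeffs_in_iff)
  then obtain m where m: "is_leading_mod \<pp> (forcing_equation R n f f\<^sub>0) m"
    using ex_leading_mod[OF assms(1) forcing_closed] by blast
  have "m \<noteq> {#}"
  proof
    assume "m = {#}"
    then have "m < {#i#}" by simp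
    then have "forcing_equation R n f f\<^sub>0 {#i#} \<in> \<pp>" using m unfolding is_leading_mod_def by blast
    then show False using assms(2,3) by (simp add: forcing_coeff_single)
  qed
  moreover have "forcing_equation R n f f\<^sub>0 m \<noteq> \<zero>"
    using m \<pp>.zero_closed by (auto simp: is_leading_mod_def)
  ultimately obtain j where "j \<in> I" "m = {#j#}"
    using forcing_coeff_other by blast
  then show ?thesis using that m by (simp add: is_leading_mod_def forcing_coeff_single)
qed

text \<open>Over the domain \<open>R/\<pp>\<close> the leading monomial of a multiple of a nonconstant polynomial is not
  constant. Hence \<open>\<pp>B\<close> and the forcing equation generate a proper ideal.\<close>

lemma forcing_nonunit_mod:
  assumes "primeideal \<pp> R" "i \<in> I" "f i \<notin> \<pp>"
    and "g \<in> carrier (polys I)" "x \<in> coeffs_in \<pp> I"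
  shows "forcing_equation R n f f\<^sub>0 \<otimes>\<^bsub>polys I\<^esub> g \<oplus>\<^bsub>polys I\<^esub> x \<noteq> \<one>\<^bsub>polys I\<^esub>"
proof
  interpret \<pp>: primeideal \<pp> R by fact
  interpret B: cring "polys I" by (rule polys_cring)
  interpret E: ideal "coeffs_in \<pp> I" "polys I"
    by (rule coeffs_in_ideal) (rule \<pp>.ideal_axioms)
  let ?h = "forcing_equation R n f f\<^sub>0"
  assume eq: "?h \<otimes>\<^bsub>polys I\<^esub> g \<oplus>\<^bsub>polys I\<^esub> x = \<one>\<^bsub>polys I\<^esub>"
  have "g \<notin> coeffs_in \<pp> I"
  proof
    assume "g \<in> coeffs_in \<pp> I"
    then have "?h \<otimes>\<^bsub>polys I\<^esub> g \<oplus>\<^bsub>polys I\<^esub> x \<in> coeffs_in \<pp> I"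
      by (intro E.a_closed E.I_l_closed forcing_closed assms(5))
    then have "indexed_const \<one> ({#} :: nat multiset) \<in> \<pp>"
      unfolding eq one_polys coeffs_in_def by blast
    then have "\<one> \<in> \<pp>" by (simp add: indexed_const_def)
    then show False using \<pp>.one_imp_carrier \<pp>.I_notcarr by simp
  qed
  then obtain l where l: "is_leading_mod \<pp> g l"
    using ex_leading_mod[OF \<pp>.ideal_axioms assms(4)] by blast
  obtain j where j: "is_leading_mod \<pp> ?h {#j#}"
    using forcing_leading_mod[OF \<pp>.ideal_axioms assms(2,3)] by blast
  let ?m = "{#j#} + l"
  have "(?h \<otimes>\<^bsub>polys I\<^esub> g) ?m \<oplus> x ?m = \<zero>"
    unfolding add_polys[symmetric, where I = "I"] eq by (simp add: one_polys indexed_const_def)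
  then have "(?h \<otimes>\<^bsub>polys I\<^esub> g) ?m \<oplus> x ?m \<in> \<pp>" using \<pp>.zero_closed by simp
  then have "(?h \<otimes>\<^bsub>polys I\<^esub> g) ?m \<in> \<pp>"
  proof (rule ideal_add_cancel[OF \<pp>.ideal_axioms, of _ "x ?m"])
    show "x ?m \<in> \<pp>" using assms(5) unfolding coeffs_in_def by blast
    show "(?h \<otimes>\<^bsub>polys I\<^esub> g) ?m \<in> carrier R"
      by (intro coeff_closed[of _ I] B.m_closed forcing_closed assms(4))
  qed
  then show False
    using leading_mod_mult[OF assms(1) forcing_closed assms(4) j l] by blast
qed

text \<open>The forcing equation is linear in \<open>T\<^sub>j\<close> with constant leading coefficient \<open>f j\<close>, the rest
  being free of \<open>T\<^sub>j\<close>.\<close>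

lemma forcing_split:
  assumes "j \<in> I"
  shows "forcing_equation R n f f\<^sub>0
      = indexed_const (f j) \<otimes>\<^bsub>polys I\<^esub> indexed_var j
        \<oplus>\<^bsub>polys I\<^esub> forcing_equation R n (f(j := \<zero>)) f\<^sub>0" (is ?eq)
    and "forcing_equation R n (f(j := \<zero>)) f\<^sub>0 \<in> carrier (polys (I - {j}))" (is ?free)
proof -
  interpret B: cring "polys I" by (rule polys_cring)
  have f': "(f(j := \<zero>)) i \<in> carrier R" if "i \<in> I" for i using f[OF that] by simp
  let ?e = "forcing_equation R n (f(j := \<zero>)) f\<^sub>0"
  have e: "?e {#} = f\<^sub>0" "\<And>i. i \<in> I \<Longrightarrow> ?e {#i#} = (f(j := \<zero>)) i"
    "\<And>m. \<lbrakk>m \<noteq> {#}; \<And>i. i \<in> I \<Longrightarrow> m \<noteq> {#i#}\<rbrakk> \<Longrightarrow> ?e m = \<zero>"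
    by (rule cring.forcing_coeff_empty[OF is_cring I f' f\<^sub>0]
      cring.forcing_coeff_single[OF is_cring I f' f\<^sub>0]
      cring.forcing_coeff_other[OF is_cring I f' f\<^sub>0]; assumption)+
  show ?eq
    using assms f f\<^sub>0
    by (intro forcing_eqI[symmetric])
      (auto simp: add_polys const_mult_var_coeff e)
  have eB: "?e \<in> carrier (polys I)"
    using I f' f\<^sub>0 by (rule cring.forcing_closed[OF is_cring])
  have "j \<notin># m" if "?e m \<noteq> \<zero>" for m
  proof
    assume "j \<in># m"
    then have "m = {#j#} \<or> (m \<noteq> {#} \<and> (\<forall>i\<in>I. m \<noteq> {#i#}))" by auto
    then show False using that e(2)[OF assms] e(3) by auto
  qed
  then show ?free using eB unfolding polys_carrier_iff by fast
qed

end

end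


section \<open>Primitive forcing equations are prime\<close>

lemma (in cring) mem_PIdl_iff: "x \<in> PIdl a \<longleftrightarrow> (\<exists>b\<in>carrier R. x = b \<otimes> a)"
  by (auto simp: cgenideal_def)

lemma (in cring) polys_mono: "J \<subseteq> I \<Longrightarrow> carrier (polys J) \<subseteq> carrier (polys I)"
  unfolding polys_carrier_iff subset_iff by blast

lemma (in cring) polys_ops_eq:
  "add (polys J) = add (polys I)" "monoid.mult (polys J) = monoid.mult (polys I)"
  by (simp_all add: poly_ring_in_def)

text \<open>This identity and the next are the induction steps of the pseudo-division below, with the
  forcing equation written as \<open>h = c x + e\<close>: in the second one the occurrence of the variable \<open>x\<close> is
  traded for \<open>-e\<close> at the price of the factor \<open>c\<close>.\<close>

lemma (in cring) clear_denominators_add: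
  assumes "{a, g, r, q, a', g', r', q', h} \<subseteq> carrier R"
    and "a \<otimes> g = r \<oplus> q \<otimes> h" "a' \<otimes> g' = r' \<oplus> q' \<otimes> h"
  shows "(a \<otimes> a') \<otimes> (g \<oplus> g') = (a' \<otimes> r \<oplus> a \<otimes> r') \<oplus> (a' \<otimes> q \<oplus> a \<otimes> q') \<otimes> h"
proof -
  have "(a \<otimes> a') \<otimes> (g \<oplus> g') = a' \<otimes> (a \<otimes> g) \<oplus> a \<otimes> (a' \<otimes> g')"
    using assms(1) by (simp, algebra)
  also have "\<dots> = a' \<otimes> (r \<oplus> q \<otimes> h) \<oplus> a \<otimes> (r' \<oplus> q' \<otimes> h)"
    using assms(2,3) by simp
  also have "\<dots> = (a' \<otimes> r \<oplus> a \<otimes> r') \<oplus> (a' \<otimes> q \<oplus> a \<otimes> q') \<otimes> h"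
    using assms(1) by (simp, algebra)
  finally show ?thesis .
qed

lemma (in cring) clear_denominators_var:
  assumes "{a, g, r, q, c, x, e} \<subseteq> carrier R" "a \<otimes> g = r \<oplus> q \<otimes> (c \<otimes> x \<oplus> e)"
  shows "(c \<otimes> a) \<otimes> (x \<otimes> g) = (\<ominus> e) \<otimes> r \<oplus> (r \<oplus> c \<otimes> x \<otimes> q) \<otimes> (c \<otimes> x \<oplus> e)"
proof -
  have "(c \<otimes> a) \<otimes> (x \<otimes> g) = c \<otimes> x \<otimes> (a \<otimes> g)" using assms(1) by (simp, algebra)
  also have "\<dots> = c \<otimes> x \<otimes> (r \<oplus> q \<otimes> (c \<otimes> x \<oplus> e))" using assms(2) by simp
  also have "\<dots> = (\<ominus> e) \<otimes> r \<oplus> (r \<oplus> c \<otimes> x \<otimes> q) \<otimes> (c \<otimes> x \<oplus> e)"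
    using assms(1) by (simp, algebra)
  finally show ?thesis .
qed

text \<open>Substituting \<open>T\<^sub>j = -e/f\<^sub>j\<close>, where \<open>e\<close> is the rest of the equation, eliminates \<open>T\<^sub>j\<close>; the factor
  \<open>a\<close> clears the denominators.\<close>

lemma (in domain) forcing_pseudo_division:
  assumes I: "I = {1..n}" and f: "\<And>i. i \<in> I \<Longrightarrow> f i \<in> carrier R" and f\<^sub>0: "f\<^sub>0 \<in> carrier R"
    and j: "j \<in> I" "f j \<noteq> \<zero>"
    and "g \<in> carrier (polys I)"
  shows "\<exists>a r q. a \<in> carrier R - {\<zero>} \<and> r \<in> carrier (polys (I - {j})) \<and> q \<in> carrier (polys I)
    \<and> indexed_const a \<otimes>\<^bsub>polys I\<^esub> g = r \<oplus>\<^bsub>polys I\<^esub> q \<otimes>\<^bsub>polys I\<^esub> forcing_equation R n f f\<^sub>0"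
  using assms(6)
proof (induction rule: polys_induct)
  interpret B: cring "polys I" by (rule polys_cring)
  let ?h = "forcing_equation R n f f\<^sub>0"
  have h: "?h \<in> carrier (polys I)" by (rule forcing_closed[where f = f, OF I f f\<^sub>0])
  interpret C: cring "polys (I - {j})" by (rule polys_cring)
  note C_eq = polys_ops_eq[of "I - {j}" I]
  have CB: "r \<in> carrier (polys I)" if "r \<in> carrier (polys (I - {j}))" for r
    using polys_mono[of "I - {j}" I] that by blast
  {
    case (const a)
    have "indexed_const a \<in> carrier (polys I)" using const by blast
    then have "indexed_const \<one> \<otimes>\<^bsub>polys I\<^esub> indexed_const a
        = indexed_const a \<oplus>\<^bsub>polys I\<^esub> \<zero>\<^bsub>polys I\<^esub> \<otimes>\<^bsub>polys I\<^esub> ?h"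
      using h by (simp add: one_polys[symmetric, of I])
    then show ?case
      using const by (intro exI[of _ \<one>] exI[of _ "indexed_const a"] exI[of _ "\<zero>\<^bsub>polys I\<^esub>"]) auto
  next
    case (add g g')
    from add.IH obtain a r q a' r' q' where a: "a \<in> carrier R - {\<zero>}" "a' \<in> carrier R - {\<zero>}"
      and r: "r \<in> carrier (polys (I - {j}))" "r' \<in> carrier (polys (I - {j}))"
      and q: "q \<in> carrier (polys I)" "q' \<in> carrier (polys I)"
      and eq: "indexed_const a \<otimes>\<^bsub>polys I\<^esub> g = r \<oplus>\<^bsub>polys I\<^esub> q \<otimes>\<^bsub>polys I\<^esub> ?h"
        "indexed_const a' \<otimes>\<^bsub>polys I\<^esub> g' = r' \<oplus>\<^bsub>polys I\<^esub> q' \<otimes>\<^bsub>polys I\<^esub> ?h"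
      by blast
    let ?a = "indexed_const a" let ?a' = "indexed_const a'"
    have ac: "?a \<in> carrier (polys I)" "?a' \<in> carrier (polys I)" using a by auto
    have "(?a \<otimes>\<^bsub>polys I\<^esub> ?a') \<otimes>\<^bsub>polys I\<^esub> (g \<oplus>\<^bsub>polys I\<^esub> g')
        = (?a' \<otimes>\<^bsub>polys I\<^esub> r \<oplus>\<^bsub>polys I\<^esub> ?a \<otimes>\<^bsub>polys I\<^esub> r')
          \<oplus>\<^bsub>polys I\<^esub> (?a' \<otimes>\<^bsub>polys I\<^esub> q \<oplus>\<^bsub>polys I\<^esub> ?a \<otimes>\<^bsub>polys I\<^esub> q') \<otimes>\<^bsub>polys I\<^esub> ?h"
      using ac r[THEN CB] q h add.hyps eq by (intro B.clear_denominators_add) simp_all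
    moreover have "?a \<otimes>\<^bsub>polys I\<^esub> ?a' = indexed_const (a \<otimes> a')"
      using a by (simp add: const_mult_const)
    moreover have "?a' \<otimes>\<^bsub>polys I\<^esub> r \<oplus>\<^bsub>polys I\<^esub> ?a \<otimes>\<^bsub>polys I\<^esub> r' \<in> carrier (polys (I - {j}))"
      using r a unfolding C_eq[symmetric] by (intro C.a_closed C.m_closed const_closed) auto
    moreover have "a \<otimes> a' \<in> carrier R - {\<zero>}" using a by (auto simp: integral_iff)
    moreover have "?a' \<otimes>\<^bsub>polys I\<^esub> q \<oplus>\<^bsub>polys I\<^esub> ?a \<otimes>\<^bsub>polys I\<^esub> q' \<in> carrier (polys I)"
      using ac q by simp
    ultimately show ?case by metis
  next
    case (var g i)
    from var.IH obtain a r q where a: "a \<in> carrier R - {\<zero>}"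
      and r: "r \<in> carrier (polys (I - {j}))" and q: "q \<in> carrier (polys I)"
      and eq: "indexed_const a \<otimes>\<^bsub>polys I\<^esub> g = r \<oplus>\<^bsub>polys I\<^esub> q \<otimes>\<^bsub>polys I\<^esub> ?h"
      by blast
    let ?a = "indexed_const a" let ?x = "indexed_var i"
    have carr: "?a \<in> carrier (polys I)" "?x \<in> carrier (polys I)" "r \<in> carrier (polys I)"
      using a var.hyps r CB by auto
    show ?case
    proof (cases "i = j")
      case False
      have "?a \<otimes>\<^bsub>polys I\<^esub> (?x \<otimes>\<^bsub>polys I\<^esub> g) = ?x \<otimes>\<^bsub>polys I\<^esub> (?a \<otimes>\<^bsub>polys I\<^esub> g)"
        using carr var.hyps by (simp add: B.m_lcomm)
      also have "\<dots> = ?x \<otimes>\<^bsub>polys I\<^esub> r \<oplus>\<^bsub>polys I\<^esub> (?x \<otimes>\<^bsub>polys I\<^esub> q) \<otimes>\<^bsub>polys I\<^esub> ?h"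
        unfolding eq using carr q h by (simp add: B.r_distr B.m_assoc)
      finally have "?a \<otimes>\<^bsub>polys I\<^esub> indexed_pmult g i
          = ?x \<otimes>\<^bsub>polys I\<^esub> r \<oplus>\<^bsub>polys I\<^esub> (?x \<otimes>\<^bsub>polys I\<^esub> q) \<otimes>\<^bsub>polys I\<^esub> ?h"
        using var.hyps by (simp add: pmult_eq_mult_var)
      moreover have "?x \<otimes>\<^bsub>polys I\<^esub> r \<in> carrier (polys (I - {j}))"
        using r False var.hyps unfolding C_eq[symmetric] by (intro C.m_closed var_closed) auto
      moreover have "?x \<otimes>\<^bsub>polys I\<^esub> q \<in> carrier (polys I)" using carr q by simp
      ultimately show ?thesis using a by blast
    next
      case True
      let ?c = "indexed_const (f j)" let ?e = "forcing_equation R n (f(j := \<zero>)) f\<^sub>0"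
      have hs: "?h = ?c \<otimes>\<^bsub>polys I\<^esub> ?x \<oplus>\<^bsub>polys I\<^esub> ?e"
        and e: "?e \<in> carrier (polys (I - {j}))"
        using forcing_split[where f = f, OF I f f\<^sub>0 j(1)] True by simp_all
      have c: "?c \<in> carrier (polys I)" using f[OF j(1)] by blast
      have "(?c \<otimes>\<^bsub>polys I\<^esub> ?a) \<otimes>\<^bsub>polys I\<^esub> (?x \<otimes>\<^bsub>polys I\<^esub> g)
          = (\<ominus>\<^bsub>polys I\<^esub> ?e) \<otimes>\<^bsub>polys I\<^esub> r
            \<oplus>\<^bsub>polys I\<^esub> (r \<oplus>\<^bsub>polys I\<^esub> ?c \<otimes>\<^bsub>polys I\<^esub> ?x \<otimes>\<^bsub>polys I\<^esub> q) \<otimes>\<^bsub>polys I\<^esub> ?h"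
        unfolding hs using carr c q CB[OF e] var.hyps eq[unfolded hs]
        by (intro B.clear_denominators_var) simp_all
      moreover have "?c \<otimes>\<^bsub>polys I\<^esub> ?a = indexed_const (f j \<otimes> a)"
        using a f[OF j(1)] by (simp add: const_mult_const)
      moreover have "f j \<otimes> a \<in> carrier R - {\<zero>}"
        using a j(2) f[OF j(1)] by (auto simp: integral_iff)
      moreover have "(\<ominus>\<^bsub>polys I\<^esub> ?e) \<otimes>\<^bsub>polys I\<^esub> r \<in> carrier (polys (I - {j}))"
      proof -
        have "\<ominus>\<^bsub>polys I\<^esub> ?e = \<ominus>\<^bsub>polys (I - {j})\<^esub> ?e"
          using e CB[OF e] by (intro ext) (simp add: polys_uminus_coeff)
        then show ?thesis
          using r e unfolding C_eq[symmetric] by (simp add: C.m_closed)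
      qed
      moreover have "r \<oplus>\<^bsub>polys I\<^esub> ?c \<otimes>\<^bsub>polys I\<^esub> ?x \<otimes>\<^bsub>polys I\<^esub> q \<in> carrier (polys I)"
        using carr c q by simp
      moreover have "indexed_pmult g i = ?x \<otimes>\<^bsub>polys I\<^esub> g"
        using var.hyps by (simp add: pmult_eq_mult_var)
      ultimately show ?thesis by metis
    qed
  }
qed

text \<open>If \<open>p g = q h\<close> and \<open>h\<close> is outside the prime ideal \<open>pB\<close>, then \<open>q\<close> is inside, and \<open>p\<close> cancels.\<close>

lemma (in domain) cancel_prime_const:
  fixes I :: "'c::linorder set"
  assumes "p \<in> carrier R" "p \<noteq> \<zero>" "primeideal (PIdl p) R"
    and "h \<in> carrier (polys I)" "h \<notin> coeffs_in (PIdl p) I" "g \<in> carrier (polys I)"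
    and "indexed_const p \<otimes>\<^bsub>polys I\<^esub> g \<in> PIdl\<^bsub>polys I\<^esub> h"
  shows "g \<in> PIdl\<^bsub>polys I\<^esub> h"
proof -
  interpret B: domain "polys I" by (rule polys_domain)
  interpret E: primeideal "coeffs_in (PIdl p) I" "polys I"
    by (rule coeffs_in_primeideal) (rule assms(3))
  let ?p = "indexed_const p"
  have "indexed_const p ({#} :: 'c multiset) = p" "\<zero>\<^bsub>polys I\<^esub> {#} = \<zero>"
    by (simp_all add: indexed_const_def polys_zero_coeff)
  then have p: "?p \<in> carrier (polys I)" "?p \<noteq> \<zero>\<^bsub>polys I\<^esub>"
    using assms(1,2) by (auto intro: const_closed)
  obtain q where q: "q \<in> carrier (polys I)" "?p \<otimes>\<^bsub>polys I\<^esub> g = q \<otimes>\<^bsub>polys I\<^esub> h"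
    using assms(7) by (auto simp: B.mem_PIdl_iff)
  have "q \<otimes>\<^bsub>polys I\<^esub> h \<in> coeffs_in (PIdl p) I"
    unfolding q(2)[symmetric] coeffs_in_PIdl[OF assms(1)] B.mem_PIdl_iff
    using p(1) assms(6) B.m_comm by blast
  then have "q \<in> coeffs_in (PIdl p) I"
    using E.I_prime[OF q(1) assms(4)] assms(5) by blast
  then obtain s where s: "s \<in> carrier (polys I)" "q = s \<otimes>\<^bsub>polys I\<^esub> ?p"
    by (auto simp: coeffs_in_PIdl[OF assms(1)] B.mem_PIdl_iff)
  then have "?p \<otimes>\<^bsub>polys I\<^esub> g = ?p \<otimes>\<^bsub>polys I\<^esub> (s \<otimes>\<^bsub>polys I\<^esub> h)"
    using q p(1) assms(4) by (simp add: B.m_ac)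
  then have "g = s \<otimes>\<^bsub>polys I\<^esub> h"
    using p s(1) assms(4,6) by (simp add: B.m_lcancel)
  then show ?thesis using s(1) by (auto simp: B.mem_PIdl_iff)
qed

text \<open>Induction on the number of irreducible factors.\<close>

lemma (in factorial_domain) irreducible_induct [consumes 1, case_names unit mult]:
  assumes "a \<in> carrier R - {\<zero>}"
    and unit: "\<And>u. u \<in> Units R \<Longrightarrow> P u"
    and mult: "\<And>p a. \<lbrakk>p \<in> carrier R; ring_irreducible p; a \<in> carrier R - {\<zero>}; P a\<rbrakk> \<Longrightarrow> P (p \<otimes> a)"
  shows "P a"
proof (cases "a \<in> Units R")
  case True
  then show ?thesis by (rule unit)
next
  case False
  then obtain fs where fs: "set fs \<subseteq> carrier R - {\<zero>}" "factors (mult_of R) fs a"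
    using factorial_monoid.factors_exist[OF factorial_monoid_axioms, of a] assms(1) by auto
  have "P (foldr (\<otimes>) gs \<one>) \<and> foldr (\<otimes>) gs \<one> \<in> carrier R - {\<zero>}" if "set gs \<subseteq> set fs" for gs
    using that
  proof (induction gs)
    case Nil
    then show ?case using unit[OF Units_one_closed] by simp
  next
    case (Cons p gs)
    then have p: "p \<in> carrier R - {\<zero>}" using fs(1) by auto
    moreover have "ring_irreducible p"
      using fs Cons.prems p by (intro ring_irreducibleI') (auto simp: factors_def)
    ultimately show ?case
      using mult[of p "foldr (\<otimes>) gs \<one>"] Cons by (auto simp: integral_iff)
  qed
  then show ?thesis using fs(2) by (auto simp: factors_def)
qed

lemma (in factorial_domain) irreducible_primeideal:
  assumes "p \<in> carrier R" "ring_irreducible p"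
  shows "primeideal (PIdl p) R"
proof -
  have "prime (mult_of R) p"
    using assms ring_irreducibleE by (intro factorial_monoid.irreducible_prime[OF factorial_monoid_axioms]) auto
  then show ?thesis
    using assms ring_irreducibleE(1) primeideal_iff_prime[of p] ring_primeI'[of p] by auto
qed

lemma (in cring) mem_PIdl_divides: "a \<in> carrier R \<Longrightarrow> x \<in> PIdl a \<longleftrightarrow> a divides x"
  unfolding mem_PIdl_iff factor_def using m_comm by metis

text \<open>Pseudo-division replaces a product in \<open>(h)\<close> by a product of two polynomials that do not contain
  \<open>T\<^sub>j\<close>. A nonzero multiple of \<open>h\<close> does contain \<open>T\<^sub>j\<close>, so one of the two vanishes, which puts a constant
  multiple of one of the original factors into \<open>(h)\<close>. The constant is then removed one irreducible
  factor at a time.\<close>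

theorem (in factorial_domain) primitive_forcing_primeideal:
  assumes I: "I = {1..n}" and f: "\<And>i. i \<in> I \<Longrightarrow> f i \<in> carrier R" and f\<^sub>0: "f\<^sub>0 \<in> carrier R"
    and "i \<in> I" "f i \<noteq> \<zero>" and prim: "no_common_irreducible_factor R (f ` I \<union> {f\<^sub>0})"
  shows "primeideal (PIdl\<^bsub>polys I\<^esub> (forcing_equation R n f f\<^sub>0)) (polys I)"
proof -
  interpret B: domain "polys I" by (rule polys_domain)
  let ?h = "forcing_equation R n f f\<^sub>0"
  have h: "?h \<in> carrier (polys I)" by (rule forcing_closed[where f = f, OF I f f\<^sub>0])
  interpret H: ideal "PIdl\<^bsub>polys I\<^esub> ?h" "polys I" by (rule B.cgenideal_ideal[OF h])
  have zero: "primeideal {\<zero>} R" "ideal {\<zero>} R" by (rule zeroprimeideal) (rule zeroideal)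
  \<comment> \<open>The eliminated variable is the leading one, so that leading monomials detect it in multiples of \<open>h\<close>.\<close>
  obtain j where j: "j \<in> I" "f j \<noteq> \<zero>" "is_leading_mod {\<zero>} ?h {#j#}"
    using forcing_leading_mod[where f = f, OF I f f\<^sub>0 zero(2) assms(4)] assms(5) by auto
  have free_zero: "r = \<zero>\<^bsub>polys I\<^esub>"
    if r: "r \<in> carrier (polys (I - {j}))" "r \<in> PIdl\<^bsub>polys I\<^esub> ?h" for r
  proof (rule ccontr)
    assume "r \<noteq> \<zero>\<^bsub>polys I\<^esub>"
    obtain t where t: "t \<in> carrier (polys I)" "r = t \<otimes>\<^bsub>polys I\<^esub> ?h"
      using r(2) by (auto simp: B.mem_PIdl_iff)
    with \<open>r \<noteq> _\<close> have "t \<notin> coeffs_in {\<zero>} I" using h by (auto simp: coeffs_in_zero)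
    then obtain l where "is_leading_mod {\<zero>} t l" using ex_leading_mod[OF zero(2) t(1)] by blast
    then have "r (l + {#j#}) \<noteq> \<zero>"
      using leading_mod_mult[OF zero(1) t(1) h _ j(3)] t(2) by blast
    then have "set_mset (l + {#j#}) \<subseteq> I - {j}" using r(1) unfolding polys_carrier_iff by blast
    then show False by auto
  qed
  have cancel: "g \<in> PIdl\<^bsub>polys I\<^esub> ?h"
    if "a \<in> carrier R - {\<zero>}" "g \<in> carrier (polys I)"
      "indexed_const a \<otimes>\<^bsub>polys I\<^esub> g \<in> PIdl\<^bsub>polys I\<^esub> ?h" for a g
    using that
  proof (induction a arbitrary: g rule: irreducible_induct)
    case (unit u)
    have u: "u \<in> carrier R" "inv u \<in> carrier R" using unit(1) by auto
    have "indexed_const (inv u) \<otimes>\<^bsub>polys I\<^esub> (indexed_const u \<otimes>\<^bsub>polys I\<^esub> g)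
        = (indexed_const (inv u) \<otimes>\<^bsub>polys I\<^esub> indexed_const u) \<otimes>\<^bsub>polys I\<^esub> g"
      using u unit.prems(1) by (intro B.m_assoc[symmetric]) auto
    also have "\<dots> = g"
      using u unit(1) unit.prems(1) by (simp add: const_mult_const one_polys[symmetric, of I])
    finally show ?case
      using H.I_l_closed[OF unit.prems(2), of "indexed_const (inv u)"] u by auto
  next
    case (mult p a)
    have a: "a \<in> carrier R" using mult.hyps by simp
    have pa: "indexed_const (p \<otimes> a) \<otimes>\<^bsub>polys I\<^esub> g
        = indexed_const p \<otimes>\<^bsub>polys I\<^esub> (indexed_const a \<otimes>\<^bsub>polys I\<^esub> g)"
      using mult.hyps(1) a mult.prems(1)
      by (simp add: B.m_assoc const_closed flip: const_mult_const[where I = I])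
    have "indexed_const a \<otimes>\<^bsub>polys I\<^esub> g \<in> PIdl\<^bsub>polys I\<^esub> ?h"
    proof (rule cancel_prime_const[of p])
      show "p \<in> carrier R" "p \<noteq> \<zero>" "primeideal (PIdl p) R"
        using mult.hyps ring_irreducibleE(1) irreducible_primeideal by blast+
      show "?h \<notin> coeffs_in (PIdl p) I"
      proof
        assume "?h \<in> coeffs_in (PIdl p) I"
        then have "\<forall>x\<in>f ` I \<union> {f\<^sub>0}. p divides x"
          using forcing_in_coeffs_in_iff[where f = f, OF I f f\<^sub>0 cgenideal_ideal[OF mult.hyps(1)]]
          by (auto simp: mem_PIdl_divides[OF mult.hyps(1)])
        then show False
          using prim mult.hyps(1,2) unfolding no_common_irreducible_factor_def by blast
      qed
      show "indexed_const p \<otimes>\<^bsub>polys I\<^esub> (indexed_const a \<otimes>\<^bsub>polys I\<^esub> g) \<in> PIdl\<^bsub>polys I\<^esub> ?h"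
        using mult.prems(2) unfolding pa .
    qed (use a h mult.prems(1) in auto)
    then show ?case using mult.IH mult.prems(1) by blast
  qed
  show ?thesis
  proof (rule primeidealI[OF H.ideal_axioms B.is_cring])
    show "carrier (polys I) \<noteq> PIdl\<^bsub>polys I\<^esub> ?h"
    proof
      assume "carrier (polys I) = PIdl\<^bsub>polys I\<^esub> ?h"
      then have "\<one>\<^bsub>polys I\<^esub> \<in> PIdl\<^bsub>polys I\<^esub> ?h" using B.one_closed by blast
      then obtain g where g: "g \<in> carrier (polys I)" "\<one>\<^bsub>polys I\<^esub> = g \<otimes>\<^bsub>polys I\<^esub> ?h"
        by (auto simp: B.mem_PIdl_iff)
      then have "?h \<otimes>\<^bsub>polys I\<^esub> g \<oplus>\<^bsub>polys I\<^esub> \<zero>\<^bsub>polys I\<^esub> = \<one>\<^bsub>polys I\<^esub>"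
        using h by (simp add: B.m_comm)
      then show False
        using forcing_nonunit_mod[where f = f, OF I f f\<^sub>0 zero(1) assms(4) _ g(1), of "\<zero>\<^bsub>polys I\<^esub>"] assms(5)
        by (simp add: coeffs_in_zero)
    qed
  next
    fix g g' assume g: "g \<in> carrier (polys I)" "g' \<in> carrier (polys I)"
      and prod: "g \<otimes>\<^bsub>polys I\<^esub> g' \<in> PIdl\<^bsub>polys I\<^esub> ?h"
    obtain a r q where a: "a \<in> carrier R - {\<zero>}" and r: "r \<in> carrier (polys (I - {j}))"
      and q: "q \<in> carrier (polys I)"
      and eq: "indexed_const a \<otimes>\<^bsub>polys I\<^esub> g = r \<oplus>\<^bsub>polys I\<^esub> q \<otimes>\<^bsub>polys I\<^esub> ?h"
      using forcing_pseudo_division[where f = f, OF I f f\<^sub>0 j(1,2) g(1)] by blast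
    obtain a' r' q' where a': "a' \<in> carrier R - {\<zero>}" and r': "r' \<in> carrier (polys (I - {j}))"
      and q': "q' \<in> carrier (polys I)"
      and eq': "indexed_const a' \<otimes>\<^bsub>polys I\<^esub> g' = r' \<oplus>\<^bsub>polys I\<^esub> q' \<otimes>\<^bsub>polys I\<^esub> ?h"
      using forcing_pseudo_division[where f = f, OF I f f\<^sub>0 j(1,2) g(2)] by blast
    let ?a = "indexed_const a" let ?a' = "indexed_const a'"
    have carr: "?a \<in> carrier (polys I)" "?a' \<in> carrier (polys I)"
      "r \<in> carrier (polys I)" "r' \<in> carrier (polys I)"
      using a a' r r' polys_mono[of "I - {j}" I] by auto
    have qh: "q \<otimes>\<^bsub>polys I\<^esub> ?h \<in> PIdl\<^bsub>polys I\<^esub> ?h" "q' \<otimes>\<^bsub>polys I\<^esub> ?h \<in> PIdl\<^bsub>polys I\<^esub> ?h"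
      using q q' by (auto simp: B.mem_PIdl_iff)
    have "(r \<oplus>\<^bsub>polys I\<^esub> q \<otimes>\<^bsub>polys I\<^esub> ?h) \<otimes>\<^bsub>polys I\<^esub> (r' \<oplus>\<^bsub>polys I\<^esub> q' \<otimes>\<^bsub>polys I\<^esub> ?h)
        = (?a \<otimes>\<^bsub>polys I\<^esub> ?a') \<otimes>\<^bsub>polys I\<^esub> (g \<otimes>\<^bsub>polys I\<^esub> g')"
      unfolding eq[symmetric] eq'[symmetric] using carr g by (simp add: B.m_ac)
    also have "\<dots> \<in> PIdl\<^bsub>polys I\<^esub> ?h" using carr by (intro H.I_l_closed prod) auto
    finally have "(r \<oplus>\<^bsub>polys I\<^esub> q \<otimes>\<^bsub>polys I\<^esub> ?h) \<otimes>\<^bsub>polys I\<^esub> (r' \<oplus>\<^bsub>polys I\<^esub> q' \<otimes>\<^bsub>polys I\<^esub> ?h)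
        \<in> PIdl\<^bsub>polys I\<^esub> ?h" .
    moreover have "(r \<oplus>\<^bsub>polys I\<^esub> q \<otimes>\<^bsub>polys I\<^esub> ?h) \<otimes>\<^bsub>polys I\<^esub> (r' \<oplus>\<^bsub>polys I\<^esub> q' \<otimes>\<^bsub>polys I\<^esub> ?h)
        = r \<otimes>\<^bsub>polys I\<^esub> r' \<oplus>\<^bsub>polys I\<^esub>
          ((r' \<otimes>\<^bsub>polys I\<^esub> q \<oplus>\<^bsub>polys I\<^esub> r \<otimes>\<^bsub>polys I\<^esub> q' \<oplus>\<^bsub>polys I\<^esub> q \<otimes>\<^bsub>polys I\<^esub> q' \<otimes>\<^bsub>polys I\<^esub> ?h) \<otimes>\<^bsub>polys I\<^esub> ?h)"
      using carr q q' h by (simp add: B.l_distr B.r_distr B.m_ac B.a_ac)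
    moreover have "(r' \<otimes>\<^bsub>polys I\<^esub> q \<oplus>\<^bsub>polys I\<^esub> r \<otimes>\<^bsub>polys I\<^esub> q' \<oplus>\<^bsub>polys I\<^esub> q \<otimes>\<^bsub>polys I\<^esub> q' \<otimes>\<^bsub>polys I\<^esub> ?h)
        \<otimes>\<^bsub>polys I\<^esub> ?h \<in> PIdl\<^bsub>polys I\<^esub> ?h"
      using carr q q' h by (intro H.I_l_closed B.cgenideal_self) auto
    ultimately have "r \<otimes>\<^bsub>polys I\<^esub> r' \<in> PIdl\<^bsub>polys I\<^esub> ?h"
      using B.ideal_add_cancel[OF H.ideal_axioms] carr B.m_closed by metis
    moreover have "r \<otimes>\<^bsub>polys I\<^esub> r' \<in> carrier (polys (I - {j}))"
      using mult_polys_closed[OF r r'] by (simp add: polys_ops_eq[of "I - {j}" I])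
    ultimately have "r \<otimes>\<^bsub>polys I\<^esub> r' = \<zero>\<^bsub>polys I\<^esub>" by (intro free_zero)
    then consider "r = \<zero>\<^bsub>polys I\<^esub>" | "r' = \<zero>\<^bsub>polys I\<^esub>"
      using B.integral carr by blast
    then show "g \<in> PIdl\<^bsub>polys I\<^esub> ?h \<or> g' \<in> PIdl\<^bsub>polys I\<^esub> ?h"
    proof cases
      case 1
      then have "?a \<otimes>\<^bsub>polys I\<^esub> g \<in> PIdl\<^bsub>polys I\<^esub> ?h" using eq qh q h by simp
      then show ?thesis using cancel[OF a g(1)] by blast
    next
      case 2
      then have "?a' \<otimes>\<^bsub>polys I\<^esub> g' \<in> PIdl\<^bsub>polys I\<^esub> ?h" using eq' qh q' h by simp
      then show ?thesis using cancel[OF a' g(2)] by blast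
    qed
  qed
qed


section \<open>Prime ideals containing an ideal\<close>

context cring
begin

text \<open>Krull's theorem: an ideal that is maximal among those avoiding \<open>1\<close> exists by Zorn's lemma.\<close>

lemma ex_prime_containing:
  assumes "ideal J R" "\<one> \<notin> J"
  shows "\<exists>P. primeideal P R \<and> J \<subseteq> P"
proof -
  define \<A> where "\<A> = {K. ideal K R \<and> J \<subseteq> K \<and> \<one> \<notin> K}"
  have "\<exists>M\<in>\<A>. \<forall>K\<in>\<A>. M \<subseteq> K \<longrightarrow> K = M"
  proof (rule subset_Zorn_nonempty)
    show "\<A> \<noteq> {}" using assms by (auto simp: \<A>_def)
    fix \<C> assume \<C>: "\<C> \<noteq> {}" "subset.chain \<A> \<C>"
    then have sub: "\<C> \<subseteq> \<A>" by (simp add: subset_chain_def)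
    then have "subset.chain {K. ideal K R} \<C>"
      using \<C>(2) by (auto simp: subset_chain_def \<A>_def)
    from chain_Union_is_ideal[OF this] have "ideal (\<Union>\<C>) R" using \<C>(1) by simp
    moreover have "J \<subseteq> \<Union>\<C>" "\<one> \<notin> \<Union>\<C>" using \<C>(1) sub by (auto simp: \<A>_def)
    ultimately show "\<Union>\<C> \<in> \<A>" by (simp add: \<A>_def)
  qed
  then obtain M where M: "ideal M R" "J \<subseteq> M" "\<one> \<notin> M"
    and max: "\<And>K. \<lbrakk>ideal K R; J \<subseteq> K; \<one> \<notin> K; M \<subseteq> K\<rbrakk> \<Longrightarrow> K = M"
    by (auto simp: \<A>_def)
  have "maximalideal M R"
  proof (rule maximalidealI[OF M(1)])
    show "carrier R \<noteq> M" using M(3) by auto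
    fix K assume K: "ideal K R" "M \<subseteq> K" "K \<subseteq> carrier R"
    then show "K = M \<or> K = carrier R"
      using max[of K] M(2) ideal.one_imp_carrier[OF K(1)] by blast
  qed
  then show ?thesis using maximalideal_prime M(2) by blast
qed

lemma ex_prime_containing_insert:
  assumes J: "ideal J R" and h: "h \<in> carrier R"
    and nonunit: "\<And>g x. \<lbrakk>g \<in> carrier R; x \<in> J\<rbrakk> \<Longrightarrow> h \<otimes> g \<oplus> x \<noteq> \<one>"
  shows "\<exists>P. primeideal P R \<and> J \<subseteq> P \<and> h \<in> P"
proof -
  interpret J: ideal J R by fact
  interpret H: ideal "PIdl h" R by (rule cgenideal_ideal[OF h])
  have K: "ideal (PIdl h <+>\<^bsub>R\<^esub> J) R" by (rule add_ideals[OF H.ideal_axioms J])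
  have "\<one> \<notin> PIdl h <+>\<^bsub>R\<^esub> J"
  proof
    assume "\<one> \<in> PIdl h <+>\<^bsub>R\<^esub> J"
    then obtain y x where yx: "y \<in> PIdl h" "x \<in> J" "\<one> = y \<oplus> x"
      unfolding set_add_def' by blast
    then obtain g where "g \<in> carrier R" "y = g \<otimes> h" by (auto simp: mem_PIdl_iff)
    then show False using nonunit[of g x] yx h by (simp add: m_comm)
  qed
  then obtain P where P: "primeideal P R" "PIdl h <+>\<^bsub>R\<^esub> J \<subseteq> P"
    using ex_prime_containing[OF K] by blast
  have "h \<oplus> \<zero> \<in> PIdl h <+>\<^bsub>R\<^esub> J"
    unfolding set_add_def' using cgenideal_self[OF h] J.zero_closed by blast
  moreover have "\<zero> \<oplus> x \<in> PIdl h <+>\<^bsub>R\<^esub> J" if "x \<in> J" for x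
    unfolding set_add_def' using that H.zero_closed by blast
  ultimately show ?thesis using P h J.Icarr by (metis l_zero r_zero subset_iff)
qed

end


section \<open>Closed subsets of the spectrum\<close>

lemma closedin_prime_locus:
  assumes "S \<subseteq> carrier R"
  shows "closedin (Spec R) (prime_locus R S)"
proof -
  have "prime_locus R S \<subseteq> topspace (Spec R)" by (auto simp: topspace_Spec prime_locus_def)
  moreover have "openin (Spec R) (topspace (Spec R) - prime_locus R S)"
    unfolding openin_Spec zariski_open_def topspace_Spec using assms by blast
  ultimately show ?thesis by (simp add: closedin_def)
qed

text \<open>\<open>P\<close> is a generic point of \<open>V(P)\<close>: every open set that meets \<open>V(P)\<close> contains it, so two such
  open sets cannot be disjoint on \<open>V(P)\<close>.\<close>

lemma connectedin_prime_locus_primeideal: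
  assumes "primeideal P R"
  shows "connectedin (Spec R) (prime_locus R P)"
  unfolding connectedin
proof (intro conjI notI)
  show "prime_locus R P \<subseteq> topspace (Spec R)" by (auto simp: topspace_Spec prime_locus_def)
  assume "\<exists>E1 E2. openin (Spec R) E1 \<and> openin (Spec R) E2 \<and> prime_locus R P \<subseteq> E1 \<union> E2
    \<and> E1 \<inter> E2 \<inter> prime_locus R P = {} \<and> E1 \<inter> prime_locus R P \<noteq> {} \<and> E2 \<inter> prime_locus R P \<noteq> {}"
  then obtain E1 E2 where E: "zariski_open R E1" "zariski_open R E2"
    "E1 \<inter> E2 \<inter> prime_locus R P = {}" "E1 \<inter> prime_locus R P \<noteq> {}" "E2 \<inter> prime_locus R P \<noteq> {}"
    by (auto simp: openin_Spec)
  have "P \<in> E" if "zariski_open R E" "E \<inter> prime_locus R P \<noteq> {}" for E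
    using that assms by (auto simp: zariski_open_def prime_locus_def)
  with E have "P \<in> E1 \<inter> E2 \<inter> prime_locus R P" using assms by (auto simp: prime_locus_def)
  with E(3) show False by blast
qed

lemma (in cring) prime_locus_PIdl:
  assumes "a \<in> carrier R"
  shows "prime_locus R (PIdl a) = prime_locus R {a}"
proof -
  have "PIdl a \<subseteq> P \<longleftrightarrow> a \<in> P" if "primeideal P R" for P
  proof -
    interpret P: primeideal P R by fact
    show ?thesis using cgenideal_minimal[OF P.ideal_axioms, of a] cgenideal_self[OF assms] by blast
  qed
  then show ?thesis by (auto simp: prime_locus_def)
qed

lemma (in cring) prime_locus_mult:
  assumes "a \<in> carrier R" "b \<in> carrier R"
  shows "prime_locus R {a \<otimes> b} = prime_locus R {a} \<union> prime_locus R {b}"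
proof -
  have "a \<otimes> b \<in> P \<longleftrightarrow> a \<in> P \<or> b \<in> P" if "primeideal P R" for P
  proof -
    interpret P: primeideal P R by fact
    show ?thesis using assms P.I_prime P.I_l_closed P.I_r_closed by blast
  qed
  then show ?thesis by (auto simp: prime_locus_def)
qed

context ideal
begin

abbreviation coset_vimage :: "'a set set \<Rightarrow> 'a set" where
  "coset_vimage Q \<equiv> {r \<in> carrier R. I +> r \<in> Q}"

lemma primeideal_coset_vimage:
  assumes "cring R" "primeideal Q (R Quot I)"
  shows "primeideal (coset_vimage Q) R" "I \<subseteq> coset_vimage Q" "(+>) I ` coset_vimage Q = Q"
proof -
  interpret Q: primeideal Q "R Quot I" by fact
  show "primeideal (coset_vimage Q) R"
    using ring_hom_ring.primeideal_vimage[OF rcos_ring_hom_ring assms] .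
  have "I \<in> Q" using additive_subgroup.zero_closed[OF Q.additive_subgroup_axioms]
    by (simp add: FactRing_def)
  moreover have "I +> r = I" if "r \<in> I" for r using that by (rule a_rcos_const)
  ultimately show "I \<subseteq> coset_vimage Q" using Icarr by auto
  have "Q \<subseteq> carrier (R Quot I)" by (rule Q.a_subset)
  then show "(+>) I ` coset_vimage Q = Q" by (fastforce simp: FactRing_def A_RCOSETS_def')
qed

text \<open>Since \<open>P\<close> contains \<open>I\<close>, it is a union of cosets, and membership in \<open>P\<close> can be tested in the
  quotient.\<close>

lemma primeideal_coset_image:
  assumes "cring R" "primeideal P R" "I \<subseteq> P"
  shows "primeideal ((+>) I ` P) (R Quot I)" "coset_vimage ((+>) I ` P) = P"
proof -
  interpret P: primeideal P R by fact
  have mem: "r \<in> P" if "r \<in> carrier R" "I +> r \<in> (+>) I ` P" for r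
  proof -
    from that(2) obtain p where p: "p \<in> P" "I +> r = I +> p" by blast
    have "r \<in> I +> p" using a_rcos_self[OF that(1)] p(2) by simp
    then obtain i where "i \<in> I" "r = i \<oplus> p" by (auto simp: a_r_coset_def')
    then show ?thesis using p(1) assms(3) P.a_closed by blast
  qed
  show vim: "coset_vimage ((+>) I ` P) = P" using mem P.Icarr by blast
  have carr: "carrier (R Quot I) = (+>) I ` carrier R"
    by (auto simp: FactRing_def A_RCOSETS_def')
  show "primeideal ((+>) I ` P) (R Quot I)"
  proof (rule primeidealI)
    show "ideal ((+>) I ` P) (R Quot I)"
      by (rule ring_ideal_imp_quot_ideal[OF ideal_axioms P.ideal_axioms])
    show "cring (R Quot I)" by (rule quotient_is_cring[OF assms(1)])
    show "carrier (R Quot I) \<noteq> (+>) I ` P"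
    proof
      assume "carrier (R Quot I) = (+>) I ` P"
      then have "\<one> \<in> P" using mem[OF one_closed] carr by blast
      then show False using P.one_imp_carrier P.I_notcarr by simp
    qed
  next
    fix x y assume "x \<in> carrier (R Quot I)" "y \<in> carrier (R Quot I)"
      and xy: "x \<otimes>\<^bsub>R Quot I\<^esub> y \<in> (+>) I ` P"
    then obtain a b where ab: "a \<in> carrier R" "x = I +> a" "b \<in> carrier R" "y = I +> b"
      unfolding carr by blast
    have "I +> (a \<otimes> b) = x \<otimes>\<^bsub>R Quot I\<^esub> y"
      using ring_hom_mult[OF rcos_ring_hom ab(1,3)] ab(2,4) by simp
    then have "a \<otimes> b \<in> P" using mem[of "a \<otimes> b"] xy ab by simp
    then have "a \<in> P \<or> b \<in> P" using P.I_prime ab by blast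
    then show "x \<in> (+>) I ` P \<or> y \<in> (+>) I ` P" using ab by blast
  qed
qed

text \<open>Pulling back along the surjection onto the quotient identifies its spectrum with \<open>V(I)\<close>. Both
  families of open sets are given by sets of ring elements, and these correspond under images and
  preimages.\<close>

theorem homeomorphic_map_Spec_quotient:
  assumes "cring R"
  shows "homeomorphic_map (Spec (R Quot I)) (subtopology (Spec R) (prime_locus R I)) coset_vimage"
proof (rule bijective_open_imp_homeomorphic_map)
  note vim = primeideal_coset_vimage[OF assms] and im = primeideal_coset_image[OF assms]
  have carr: "carrier (R Quot I) = (+>) I ` carrier R"
    by (auto simp: FactRing_def A_RCOSETS_def')
  have top: "topspace (subtopology (Spec R) (prime_locus R I)) = prime_locus R I"
    by (auto simp: topspace_Spec prime_locus_def)
  have surj: "coset_vimage ` topspace (Spec (R Quot I)) = prime_locus R I"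
  proof (intro subset_antisym subsetI)
    fix P assume "P \<in> prime_locus R I"
    then have "primeideal P R" "I \<subseteq> P" by (simp_all add: prime_locus_def)
    then show "P \<in> coset_vimage ` topspace (Spec (R Quot I))"
      using im[of P] by (intro image_eqI[of _ _ "(+>) I ` P"]) (simp_all add: topspace_Spec)
  next
    fix P assume "P \<in> coset_vimage ` topspace (Spec (R Quot I))"
    then obtain Q where "primeideal Q (R Quot I)" "P = coset_vimage Q" by (auto simp: topspace_Spec)
    then show "P \<in> prime_locus R I" using vim[of Q] by (simp add: prime_locus_def)
  qed
  then show "coset_vimage ` topspace (Spec (R Quot I))
      = topspace (subtopology (Spec R) (prime_locus R I))"
    by (simp only: top)
  show "inj_on coset_vimage (topspace (Spec (R Quot I)))"
    using vim(3) by (intro inj_on_inverseI[where g = "(`) ((+>) I)"]) (simp add: topspace_Spec)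
  show "continuous_map (Spec (R Quot I)) (subtopology (Spec R) (prime_locus R I)) coset_vimage"
  proof (rule continuous_map_into_subtopology)
    show "coset_vimage \<in> topspace (Spec (R Quot I)) \<rightarrow> prime_locus R I" using surj by blast
    show "continuous_map (Spec (R Quot I)) (Spec R) coset_vimage"
      unfolding continuous_map
    proof (intro conjI allI impI)
      show "coset_vimage ` topspace (Spec (R Quot I)) \<subseteq> topspace (Spec R)"
        using surj by (auto simp: topspace_Spec prime_locus_def)
      fix U assume "openin (Spec R) U"
      then obtain S where S: "S \<subseteq> carrier R" "U = {P. primeideal P R} - prime_locus R S"
        by (auto simp: openin_Spec zariski_open_def)
      have "coset_vimage Q \<in> U \<longleftrightarrow> \<not> (+>) I ` S \<subseteq> Q" if "primeideal Q (R Quot I)" for Q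
        using vim(1)[OF that] S by (auto simp: prime_locus_def)
      then have "{Q \<in> topspace (Spec (R Quot I)). coset_vimage Q \<in> U}
          = {Q. primeideal Q (R Quot I)} - prime_locus (R Quot I) ((+>) I ` S)"
        unfolding topspace_Spec prime_locus_def by blast
      moreover have "(+>) I ` S \<subseteq> carrier (R Quot I)" unfolding carr using S(1) by (rule image_mono)
      ultimately show "openin (Spec (R Quot I)) {Q \<in> topspace (Spec (R Quot I)). coset_vimage Q \<in> U}"
        unfolding openin_Spec zariski_open_def by (intro exI conjI)
    qed
  qed
  show "open_map (Spec (R Quot I)) (subtopology (Spec R) (prime_locus R I)) coset_vimage"
    unfolding open_map_def
  proof (intro allI impI)
    fix U assume "openin (Spec (R Quot I)) U"
    then obtain T where T: "T \<subseteq> (+>) I ` carrier R"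
      "U = {Q. primeideal Q (R Quot I)} - prime_locus (R Quot I) T"
      by (auto simp: openin_Spec zariski_open_def carr)
    let ?V = "{P. primeideal P R} - prime_locus R (coset_vimage T)"
    have iff: "T \<subseteq> Q \<longleftrightarrow> coset_vimage T \<subseteq> coset_vimage Q" for Q using T(1) by blast
    have "coset_vimage ` U = ?V \<inter> prime_locus R I"
    proof (intro subset_antisym subsetI)
      fix P assume "P \<in> coset_vimage ` U"
      then obtain Q where "Q \<in> U" "P = coset_vimage Q" by blast
      then show "P \<in> ?V \<inter> prime_locus R I"
        using vim[of Q] iff[of Q] T(2) by (simp add: prime_locus_def)
    next
      fix P assume P: "P \<in> ?V \<inter> prime_locus R I"
      then have P': "primeideal P R" "I \<subseteq> P" "\<not> coset_vimage T \<subseteq> P"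
        by (simp_all add: prime_locus_def)
      then have "\<not> T \<subseteq> (+>) I ` P" using im(2)[of P] by blast
      then have "(+>) I ` P \<in> U" using im(1)[of P] P' T(2) by (simp add: prime_locus_def)
      then show "P \<in> coset_vimage ` U"
        using im(2)[OF P'(1,2)] by (intro image_eqI[of _ _ "(+>) I ` P"]) simp_all
    qed
    moreover have "openin (Spec R) ?V"
      unfolding openin_Spec zariski_open_def
      by (intro exI[of _ "coset_vimage T"] conjI refl) simp
    ultimately show "openin (subtopology (Spec R) (prime_locus R I)) (coset_vimage ` U)"
      unfolding openin_subtopology by (intro exI[of _ ?V] conjI)
  qed
qed

corollary nonempty_connected_Spec_quotient_iff:
  assumes "cring R"
  shows "nonempty_connected_space (Spec (R Quot I)) \<longleftrightarrow>
    prime_locus R I \<noteq> {} \<and> connectedin (Spec R) (prime_locus R I)"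
proof -
  let ?Y = "subtopology (Spec R) (prime_locus R I)"
  have sub: "prime_locus R I \<subseteq> topspace (Spec R)" by (auto simp: topspace_Spec prime_locus_def)
  note hom = homeomorphic_map_Spec_quotient[OF assms]
  have "topspace (Spec (R Quot I)) \<noteq> {} \<longleftrightarrow> prime_locus R I \<noteq> {}"
    using homeomorphic_imp_surjective_map[OF hom] sub by auto
  moreover have "connected_space (Spec (R Quot I)) \<longleftrightarrow> connected_space ?Y"
    by (rule homeomorphic_connected_space[OF homeomorphic_map_imp_homeomorphic_space[OF hom]])
  ultimately show ?thesis
    using sub by (simp add: nonempty_connected_space_def connectedin_def)
qed

end


section \<open>The spectrum of a forcing algebra\<close>

text \<open>The irreducible factors \<open>p\<close> of \<open>a\<close> are adjoined one at a time. Each adds the irreducible set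
  \<open>V(p)\<close>, which meets \<open>V(h)\<close> because \<open>pB\<close> and \<open>h\<close> generate a proper ideal.\<close>

theorem (in factorial_domain) connectedin_prime_locus_forcing:
  assumes I: "I = {1..n}" and f: "\<And>i. i \<in> I \<Longrightarrow> f i \<in> carrier R" and f\<^sub>0: "f\<^sub>0 \<in> carrier R"
    and "i \<in> I" "f i \<noteq> \<zero>" and prim: "no_common_irreducible_factor R (f ` I \<union> {f\<^sub>0})"
    and "a \<in> carrier R - {\<zero>}"
    and "\<And>p. \<lbrakk>p \<in> carrier R; ring_irreducible p; p divides a\<rbrakk> \<Longrightarrow> \<exists>i\<in>I. \<not> p divides f i"
  shows "connectedin (Spec (polys I))
    (prime_locus (polys I) {indexed_const a \<otimes>\<^bsub>polys I\<^esub> forcing_equation R n f f\<^sub>0})"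
  using assms(7,8)
proof (induction a rule: irreducible_induct)
  interpret B: domain "polys I" by (rule polys_domain)
  let ?h = "forcing_equation R n f f\<^sub>0"
  have h: "?h \<in> carrier (polys I)" by (rule forcing_closed[where f = f, OF I f f\<^sub>0])
  have locus_mult: "prime_locus (polys I) {indexed_const a \<otimes>\<^bsub>polys I\<^esub> ?h}
      = prime_locus (polys I) {indexed_const a} \<union> prime_locus (polys I) {?h}"
    if "a \<in> carrier R" for a
    using that h by (intro B.prime_locus_mult const_closed)
  {
    case (unit u)
    have prime: "primeideal (PIdl\<^bsub>polys I\<^esub> ?h) (polys I)"
      by (rule primitive_forcing_primeideal[where f = f, OF I f f\<^sub>0 assms(4,5) prim])
    have "indexed_const u \<notin> P" if "primeideal P (polys I)" for P
    proof
      interpret P: primeideal P "polys I" by (rule that)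
      assume "indexed_const u \<in> P"
      then have "indexed_const u \<otimes>\<^bsub>polys I\<^esub> indexed_const (inv u) \<in> P"
        using unit by (intro P.I_r_closed const_closed) auto
      then have "\<one>\<^bsub>polys I\<^esub> \<in> P"
        using unit by (simp add: const_mult_const one_polys Units_closed)
      then show False using P.one_imp_carrier P.I_notcarr by simp
    qed
    then have "prime_locus (polys I) {indexed_const u} = {}" by (auto simp: prime_locus_def)
    then show ?case
      using connectedin_prime_locus_primeideal[OF prime] unit locus_mult[of u]
        B.prime_locus_PIdl[OF h] by auto
  next
    case (mult p a)
    have a: "a \<in> carrier R" using mult.hyps by simp
    have p_ideal: "primeideal (PIdl p) R" using mult.hyps by (intro irreducible_primeideal)
    note ext = coeffs_in_primeideal[OF p_ideal, of I]
    have dvd_pa: "p divides p \<otimes> a" using a by (auto simp: factor_def)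
    obtain i where i: "i \<in> I" "\<not> p divides f i" using mult.prems[OF mult.hyps(1,2) dvd_pa] by blast
    have "f i \<notin> PIdl p" using i(2) by (simp add: mem_PIdl_divides[OF mult.hyps(1)])
    then have "\<exists>P. primeideal P (polys I) \<and> coeffs_in (PIdl p) I \<subseteq> P \<and> ?h \<in> P"
      using forcing_nonunit_mod[where f = f, OF I f f\<^sub>0 p_ideal i(1)]
      by (intro B.ex_prime_containing_insert[OF primeideal.axioms(1)[OF ext] h])
    moreover have locus_p: "prime_locus (polys I) (coeffs_in (PIdl p) I)
        = prime_locus (polys I) {indexed_const p}"
      unfolding coeffs_in_PIdl[OF mult.hyps(1)]
      using mult.hyps(1) by (intro B.prime_locus_PIdl const_closed)
    ultimately have meet: "prime_locus (polys I) {indexed_const p}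
        \<inter> prime_locus (polys I) {indexed_const a \<otimes>\<^bsub>polys I\<^esub> ?h} \<noteq> {}"
      unfolding locus_mult[OF a] by (auto simp: prime_locus_def)
    have "prime_locus (polys I) {indexed_const (p \<otimes> a)}
        = prime_locus (polys I) {indexed_const p} \<union> prime_locus (polys I) {indexed_const a}"
      using mult.hyps(1) a
      by (simp add: B.prime_locus_mult const_closed flip: const_mult_const[where I = I])
    then have "prime_locus (polys I) {indexed_const (p \<otimes> a) \<otimes>\<^bsub>polys I\<^esub> ?h}
        = prime_locus (polys I) {indexed_const p}
          \<union> prime_locus (polys I) {indexed_const a \<otimes>\<^bsub>polys I\<^esub> ?h}"
      using locus_mult[OF a] locus_mult[of "p \<otimes> a"] mult.hyps(1) a by auto
    moreover have "connectedin (Spec (polys I)) (prime_locus (polys I) {indexed_const p})"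
      using connectedin_prime_locus_primeideal[OF ext] by (simp add: locus_p)
    moreover have "connectedin (Spec (polys I))
        (prime_locus (polys I) {indexed_const a \<otimes>\<^bsub>polys I\<^esub> ?h})"
    proof (rule mult.IH)
      fix q assume "q \<in> carrier R" "ring_irreducible q" "q divides a"
      moreover from this have "q divides p \<otimes> a"
        using a mult.hyps(1) by (intro divides_prod_l)
      ultimately show "\<exists>i\<in>I. \<not> q divides f i" using mult.prems by blast
    qed
    ultimately show ?case using meet by (simp add: connectedin_Un)
  }
qed

text \<open>Collecting in \<open>b\<close> the irreducible factors of \<open>a\<close> that are not associated to \<open>p\<close> makes \<open>a\<close>, up to
  a unit, a power of \<open>p\<close> times \<open>b\<close>. The condition on prime ideals says that \<open>V(a) \<subseteq> V(p) \<union> V(b)\<close>.\<close>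

lemma (in factorial_domain) remove_irreducible_factor:
  assumes p: "p \<in> carrier R" "ring_irreducible p" and "a \<in> carrier R - {\<zero>}"
  shows "\<exists>b\<in>carrier R. b divides a \<and> \<not> p divides b
    \<and> (\<forall>P. primeideal P R \<longrightarrow> a \<in> P \<longrightarrow> p \<in> P \<or> b \<in> P)"
  using assms(3)
proof (induction a rule: irreducible_induct)
  interpret PP: primeideal "PIdl p" R by (rule irreducible_primeideal[OF p])
  {
    case (unit u)
    have "\<not> p divides u"
    proof
      assume "p divides u"
      then have "p \<in> Units R" using divides_unit p(1) unit by blast
      then show False using ring_irreducibleE(4)[OF p] by blast
    qed
    then show ?case using unit by (intro bexI[of _ u]) auto
  next
    case (mult q a)
    from mult.IH obtain b where b: "b \<in> carrier R" "b divides a" "\<not> p divides b"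
      "\<And>P. \<lbrakk>primeideal P R; a \<in> P\<rbrakk> \<Longrightarrow> p \<in> P \<or> b \<in> P" by blast
    have a: "a \<in> carrier R" using mult.hyps by simp
    have prime: "q \<in> P \<or> a \<in> P" if "primeideal P R" "q \<otimes> a \<in> P" for P
      using primeideal.I_prime[OF that(1) mult.hyps(1) a that(2)] .
    show ?case
    proof (cases "p divides q")
      case True
      then obtain u where u: "u \<in> carrier R" "q = p \<otimes> u" by (auto simp: factor_def)
      then have "u \<in> Units R"
        using ring_irreducibleE(5)[OF mult.hyps(1,2) p(1) u(1)] ring_irreducibleE(4)[OF p] by blast
      then have "p = q \<otimes> inv u" using u p(1) by (simp add: m_assoc)
      then have "p \<in> P" if "primeideal P R" "q \<in> P" for P
        using ideal.I_r_closed[OF primeideal.axioms(1)[OF that(1)] that(2)] \<open>u \<in> Units R\<close>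
        by (metis Units_inv_closed)
      then have "p \<in> P \<or> b \<in> P" if "primeideal P R" "q \<otimes> a \<in> P" for P
        using prime[OF that] b(4) that(1) by blast
      moreover have "b divides q \<otimes> a" using b(1,2) a mult.hyps(1) by (intro divides_prod_l)
      ultimately show ?thesis using b by blast
    next
      case False
      have "q \<otimes> b \<notin> PIdl p"
        using PP.I_prime[OF mult.hyps(1) b(1)] False b(3) by (simp only: mem_PIdl_divides[OF p(1)]) blast
      then have "\<not> p divides q \<otimes> b" by (simp only: mem_PIdl_divides[OF p(1)] not_False_eq_True)
      moreover have "p \<in> P \<or> q \<otimes> b \<in> P" if "primeideal P R" "q \<otimes> a \<in> P" for P
      proof -
        interpret P: primeideal P R by (rule that(1))
        show ?thesis
          using prime[OF that] b(4)[OF that(1)] P.I_r_closed[of q b] P.I_l_closed[of b q]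
            b(1) mult.hyps(1) by blast
      qed
      moreover have "q \<otimes> b divides q \<otimes> a" using b mult.hyps(1) by (intro divides_mult)
      ultimately show ?thesis using b(1) mult.hyps(1) by (intro bexI[of _ "q \<otimes> b"]) auto
    qed
  }
qed

text \<open>With \<open>b\<close> the part of \<open>a\<close> prime to \<open>p\<close>, the closed sets \<open>V(p)\<close> and \<open>V(b h)\<close> cover \<open>V(a h)\<close>. A prime
  ideal in both would contract to the maximal ideal \<open>(p)\<close> of \<open>R\<close>, which contains neither \<open>b\<close> nor the
  constant term \<open>f\<^sub>0\<close>, while \<open>h\<close> is congruent to \<open>f\<^sub>0\<close> modulo \<open>p\<close>.\<close>

theorem (in principal_domain) not_connectedin_prime_locus_forcing:
  assumes I: "I = {1..n}" and f: "\<And>i. i \<in> I \<Longrightarrow> f i \<in> carrier R" and f\<^sub>0: "f\<^sub>0 \<in> carrier R"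
    and "i \<in> I" "f i \<noteq> \<zero>" and prim: "no_common_irreducible_factor R (f ` I \<union> {f\<^sub>0})"
    and a: "a \<in> carrier R - {\<zero>}"
    and p: "p \<in> carrier R" "ring_irreducible p" "p divides a" "\<And>i. i \<in> I \<Longrightarrow> p divides f i"
  shows "\<not> connectedin (Spec (polys I))
    (prime_locus (polys I) {indexed_const a \<otimes>\<^bsub>polys I\<^esub> forcing_equation R n f f\<^sub>0})"
proof -
  interpret B: domain "polys I" by (rule polys_domain)
  let ?h = "forcing_equation R n f f\<^sub>0" let ?B = "polys I"
  let ?V = "\<lambda>x. prime_locus ?B {x}"
  have h: "?h \<in> carrier ?B" by (rule forcing_closed[where f = f, OF I f f\<^sub>0])
  have p_ideal: "primeideal (PIdl p) R" using p by (intro irreducible_primeideal)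
  interpret PP: primeideal "PIdl p" R by (rule p_ideal)
  have p_max: "maximalideal (PIdl p) R"
    by (rule irreducible_imp_maximalideal[OF p(1,2)])
  obtain b where b: "b \<in> carrier R" "b divides a" "\<not> p divides b"
    and "\<And>P. \<lbrakk>primeideal P R; a \<in> P\<rbrakk> \<Longrightarrow> p \<in> P \<or> b \<in> P"
    using remove_irreducible_factor[OF p(1,2) a] by blast
  note sep = this(4)
  have const_carr: "indexed_const a \<in> carrier ?B" "indexed_const b \<in> carrier ?B" "indexed_const p \<in> carrier ?B"
    using a b(1) p(1) by auto
  have contract: "primeideal {r \<in> carrier R. indexed_const r \<in> Q} R" if "primeideal Q ?B" for Q
    using ring_hom_ring.primeideal_vimage[OF const_ring_hom is_cring that] .
  have const_dvd: "indexed_const y \<in> Q"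
    if Q: "primeideal Q ?B" and x: "indexed_const x \<in> Q" "x divides y" "x \<in> carrier R" for Q x y
  proof -
    interpret Q: primeideal Q ?B by (rule Q)
    obtain z where z: "z \<in> carrier R" "y = x \<otimes> z" using x(2) by (auto simp: factor_def)
    then show ?thesis
      using Q.I_r_closed[OF x(1), of "indexed_const z"] x(3)
      by (simp add: const_closed const_mult_const)
  qed
  have V_ah: "?V (indexed_const a \<otimes>\<^bsub>?B\<^esub> ?h) = ?V (indexed_const a) \<union> ?V ?h"
    and V_bh: "?V (indexed_const b \<otimes>\<^bsub>?B\<^esub> ?h) = ?V (indexed_const b) \<union> ?V ?h"
    using const_carr h by (simp_all only: B.prime_locus_mult)
  have cover: "?V (indexed_const a) \<subseteq> ?V (indexed_const p) \<union> ?V (indexed_const b)"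
    using sep[OF contract] a by (auto simp: prime_locus_def)
  have p_iff: "x \<in> PIdl p \<longleftrightarrow> p divides x" for x by (rule mem_PIdl_divides[OF p(1)])
  have f\<^sub>0_p: "f\<^sub>0 \<notin> PIdl p"
  proof
    assume "f\<^sub>0 \<in> PIdl p"
    then have "\<forall>x\<in>f ` I \<union> {f\<^sub>0}. p divides x" using p(4) unfolding p_iff by blast
    then show False using prim p(1,2) unfolding no_common_irreducible_factor_def by blast
  qed
  have disjoint: "?V (indexed_const p) \<inter> (?V (indexed_const b) \<union> ?V ?h) = {}"
  proof (rule ccontr)
    assume "\<not> ?thesis"
    then obtain Q where Q: "primeideal Q ?B" "indexed_const p \<in> Q" "indexed_const b \<in> Q \<or> ?h \<in> Q"
      by (auto simp: prime_locus_def)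
    interpret Q: primeideal Q ?B by (rule Q(1))
    define K where K: "K = {r \<in> carrier R. indexed_const r \<in> Q}"
    interpret K: primeideal K R unfolding K by (rule contract[OF Q(1)])
    have "p \<in> K" using Q(2) p(1) unfolding K by blast
    then have "PIdl p \<subseteq> K" by (rule cgenideal_minimal[OF K.ideal_axioms])
    then have "K = PIdl p"
      using maximalideal.I_maximal[OF p_max K.ideal_axioms _ K.a_subset] K.I_notcarr by blast
    then have contr: "r \<in> PIdl p" if "r \<in> carrier R" "indexed_const r \<in> Q" for r
      using that K by blast
    from Q(3) show False
    proof
      assume "indexed_const b \<in> Q"
      then have "b \<in> PIdl p" by (rule contr[OF b(1)])
      then show False using b(3) unfolding p_iff by blast
    next
      assume hQ: "?h \<in> Q"
      let ?l = "forcing_equation R n f \<zero>"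
      have "\<zero> \<in> PIdl p \<and> (\<forall>i\<in>I. f i \<in> PIdl p)"
        using p(4) divides_zero[OF p(1)] unfolding p_iff by blast
      then have "?l \<in> coeffs_in (PIdl p) I"
        using forcing_in_coeffs_in_iff[where f = f, OF I f zero_closed PP.ideal_axioms] by blast
      then have "?l \<in> Q"
        using B.cgenideal_minimal[OF Q.ideal_axioms Q(2)] unfolding coeffs_in_PIdl[OF p(1)] by blast
      moreover have "indexed_const f\<^sub>0 \<oplus>\<^bsub>?B\<^esub> ?l = ?h"
      proof (rule forcing_eqI[where f = f, OF I f f\<^sub>0])
        have l: "?l {#} = \<zero>" "\<And>i. i \<in> I \<Longrightarrow> ?l {#i#} = f i"
          "\<And>m. \<lbrakk>m \<noteq> {#}; \<And>i. i \<in> I \<Longrightarrow> m \<noteq> {#i#}\<rbrakk> \<Longrightarrow> ?l m = \<zero>"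
          by (rule forcing_coeff_empty[where f = f, OF I f zero_closed]
            forcing_coeff_single[where f = f, OF I f zero_closed]
            forcing_coeff_other[where f = f, OF I f zero_closed]; assumption)+
        show "(indexed_const f\<^sub>0 \<oplus>\<^bsub>?B\<^esub> ?l) {#} = f\<^sub>0"
          unfolding add_polys l(1) using f\<^sub>0 by (simp add: indexed_const_def)
        show "(indexed_const f\<^sub>0 \<oplus>\<^bsub>?B\<^esub> ?l) {#i#} = f i" if "i \<in> I" for i
          unfolding add_polys l(2)[OF that] using f[OF that] by (simp add: indexed_const_def)
        show "(indexed_const f\<^sub>0 \<oplus>\<^bsub>?B\<^esub> ?l) m = \<zero>"
          if m: "m \<noteq> {#}" "\<And>i. i \<in> I \<Longrightarrow> m \<noteq> {#i#}" for m
        proof -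
          have "?l m = \<zero>" using m by (rule l(3))
          then show ?thesis using m(1) by (simp add: add_polys indexed_const_def)
        qed
      qed
      then have "indexed_const f\<^sub>0 \<oplus>\<^bsub>?B\<^esub> ?l \<in> Q" using hQ by (simp only:)
      ultimately have "indexed_const f\<^sub>0 \<in> Q"
        using B.ideal_add_cancel[OF Q.ideal_axioms] const_closed[OF f\<^sub>0] by blast
      then show False using f\<^sub>0_p contr[OF f\<^sub>0] by blast
    qed
  qed
  have ne_p: "PIdl\<^bsub>?B\<^esub> (indexed_const p) \<in> ?V (indexed_const p)"
    using coeffs_in_primeideal[OF p_ideal, of I] B.cgenideal_self[OF const_carr(3)]
    by (simp add: prime_locus_def coeffs_in_PIdl[OF p(1)])
  have ne_h: "PIdl\<^bsub>?B\<^esub> ?h \<in> ?V ?h"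
    using primitive_forcing_primeideal[where f = f, OF I f f\<^sub>0 assms(4,5) prim] B.cgenideal_self[OF h]
    by (simp add: prime_locus_def)
  have p_sub: "?V (indexed_const p) \<subseteq> ?V (indexed_const a)"
    using const_dvd[OF _ _ p(3) p(1)] by (auto simp: prime_locus_def)
  let ?X = "?V (indexed_const a \<otimes>\<^bsub>?B\<^esub> ?h)"
  have "closedin (Spec ?B) (?V (indexed_const p))" "closedin (Spec ?B) (?V (indexed_const b \<otimes>\<^bsub>?B\<^esub> ?h))"
    using const_carr h by (auto intro!: closedin_prime_locus)
  moreover have "?X \<subseteq> ?V (indexed_const p) \<union> ?V (indexed_const b \<otimes>\<^bsub>?B\<^esub> ?h)"
    unfolding V_ah V_bh using cover by blast
  moreover have "?V (indexed_const p) \<inter> ?V (indexed_const b \<otimes>\<^bsub>?B\<^esub> ?h) \<inter> ?X = {}"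
    unfolding V_bh using disjoint by blast
  moreover have "?V (indexed_const p) \<inter> ?X \<noteq> {}" "?V (indexed_const b \<otimes>\<^bsub>?B\<^esub> ?h) \<inter> ?X \<noteq> {}"
    unfolding V_ah V_bh using ne_p p_sub ne_h by blast+
  ultimately show ?thesis unfolding connectedin_closedin by blast
qed

lemma (in domain) exact_quotient_works:
  assumes "d \<in> carrier R" "d \<noteq> \<zero>" "d divides a"
  shows "exact_quotient R a d \<in> carrier R" "a = d \<otimes> exact_quotient R a d"
proof -
  obtain c where c: "c \<in> carrier R" "a = d \<otimes> c" using assms(3) by (auto simp: factor_def)
  have "exact_quotient R a d = c"
    unfolding exact_quotient_def using c assms(1,2) by (intro the_equality) (auto simp: m_lcancel)
  then show "exact_quotient R a d \<in> carrier R" "a = d \<otimes> exact_quotient R a d" using c by simp_all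
qed

text \<open>The quotients \<open>f\<^sub>i/d\<close> and \<open>f/d\<close> have no common irreducible factor because \<open>d\<close> is a greatest
  common divisor, so the two results on \<open>V(d h')\<close> apply.\<close>

theorem (in factorial_domain) connected_Spec_forcing_algebra:
  assumes f: "\<And>i. i \<in> {1..n} \<Longrightarrow> f i \<in> carrier R" and f\<^sub>0: "f\<^sub>0 \<in> carrier R"
    and gcd: "is_gcd_of R d (f ` {1..n} \<union> {f\<^sub>0})" and nz: "\<exists>i\<in>{1..n}. f i \<noteq> \<zero>"
  defines "cond \<equiv> no_common_irreducible_factor R ({d} \<union> (\<lambda>i. exact_quotient R (f i) d) ` {1..n})"
  shows "cond \<Longrightarrow> nonempty_connected_space (Spec (forcing_algebra R n f f\<^sub>0))"
    and "principal_domain R \<Longrightarrow> \<not> cond \<Longrightarrow> \<not> nonempty_connected_space (Spec (forcing_algebra R n f f\<^sub>0))"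
proof -
  define I where I: "I = {1..n}"
  interpret B: domain "polys I" by (rule polys_domain)
  define g where "g i = exact_quotient R (f i) d" for i
  define g\<^sub>0 where "g\<^sub>0 = exact_quotient R f\<^sub>0 d"
  obtain i where i: "i \<in> I" "f i \<noteq> \<zero>" using nz I by blast
  have d: "d \<in> carrier R" and d_dvd: "\<And>i. i \<in> I \<Longrightarrow> d divides f i" "d divides f\<^sub>0"
    and d_greatest: "\<And>e. \<lbrakk>e \<in> carrier R; \<And>i. i \<in> I \<Longrightarrow> e divides f i; e divides f\<^sub>0\<rbrakk> \<Longrightarrow> e divides d"
    using gcd by (auto simp: is_gcd_of_def I)
  have d0: "d \<noteq> \<zero>" using d_dvd(1)[OF i(1)] i(2) zero_divides by blast
  have g: "g i \<in> carrier R" "f i = d \<otimes> g i" if "i \<in> I" for i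
    unfolding g_def using exact_quotient_works[OF d d0 d_dvd(1)[OF that]] by simp_all
  have g\<^sub>0: "g\<^sub>0 \<in> carrier R" "f\<^sub>0 = d \<otimes> g\<^sub>0"
    unfolding g\<^sub>0_def using exact_quotient_works[OF d d0 d_dvd(2)] by simp_all
  have gi: "g i \<noteq> \<zero>" using g(2)[OF i(1)] i(2) d by auto
  have prim: "no_common_irreducible_factor R (g ` I \<union> {g\<^sub>0})"
    unfolding no_common_irreducible_factor_def
  proof
    assume "\<exists>p\<in>carrier R. ring_irreducible p \<and> (\<forall>x\<in>g ` I \<union> {g\<^sub>0}. p divides x)"
    then obtain p where p: "p \<in> carrier R" "ring_irreducible p"
      "\<And>i. i \<in> I \<Longrightarrow> p divides g i" "p divides g\<^sub>0" by blast
    have "d \<otimes> p divides d"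
    proof (rule d_greatest)
      show "d \<otimes> p divides f i" if "i \<in> I" for i
        unfolding g(2)[OF that] using p(1,3) d that by (intro divides_mult)
      show "d \<otimes> p divides f\<^sub>0" unfolding g\<^sub>0(2) using p(1,4) d by (intro divides_mult)
    qed (use d p in simp)
    then have "d \<otimes> p divides d \<otimes> \<one>" using d by simp
    then have "p divides \<one>" using d d0 p(1) by (intro mult_divides[of p \<one> d]) auto
    then show False using divides_one[OF p(1)] ring_irreducibleE(4)[OF p(1,2)] by blast
  qed
  let ?h = "forcing_equation R n g g\<^sub>0"
  have h: "?h \<in> carrier (polys I)" by (rule forcing_closed[where f = g, OF I g(1) g\<^sub>0(1)])
  have "forcing_equation R n f f\<^sub>0 = forcing_equation R n (\<lambda>i. d \<otimes> g i) (d \<otimes> g\<^sub>0)"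
  proof (rule forcing_eqI[OF I])
    have f': "f i \<in> carrier R" if "i \<in> I" for i using f that I by simp
    note c = forcing_coeff_empty[where f = f, OF I f' f\<^sub>0]
      forcing_coeff_single[where f = f, OF I f' f\<^sub>0]
      forcing_coeff_other[where f = f, OF I f' f\<^sub>0]
    show "forcing_equation R n f f\<^sub>0 {#} = d \<otimes> g\<^sub>0" using c(1) g\<^sub>0 by simp
    show "forcing_equation R n f f\<^sub>0 {#i#} = d \<otimes> g i" if "i \<in> I" for i
      using c(2) g that by simp
    show "forcing_equation R n f f\<^sub>0 m = \<zero>"
      if "m \<noteq> {#}" "\<And>i. i \<in> I \<Longrightarrow> m \<noteq> {#i#}" for m
      using c(3) that by simp
  qed (use d g g\<^sub>0 in auto)
  then have scale: "forcing_equation R n f f\<^sub>0 = indexed_const d \<otimes>\<^bsub>polys I\<^esub> ?h"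
    using forcing_scale[where f = g, OF I g(1) g\<^sub>0(1) d] by simp
  let ?J = "PIdl\<^bsub>polys I\<^esub> (indexed_const d \<otimes>\<^bsub>polys I\<^esub> ?h)"
  let ?V = "prime_locus (polys I) {indexed_const d \<otimes>\<^bsub>polys I\<^esub> ?h}"
  have dh: "indexed_const d \<otimes>\<^bsub>polys I\<^esub> ?h \<in> carrier (polys I)" using d h by auto
  have alg: "forcing_algebra R n f f\<^sub>0 = polys I Quot ?J"
    unfolding forcing_algebra_def Let_def I[symmetric] scale ..
  have "PIdl\<^bsub>polys I\<^esub> ?h \<in> prime_locus (polys I) {?h}"
    using primitive_forcing_primeideal[where f = g, OF I g(1) g\<^sub>0(1) i(1) gi prim] B.cgenideal_self[OF h]
    by (simp add: prime_locus_def)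
  then have "?V \<noteq> {}" using d h by (auto simp: B.prime_locus_mult const_closed)
  then have iff: "nonempty_connected_space (Spec (forcing_algebra R n f f\<^sub>0))
      \<longleftrightarrow> connectedin (Spec (polys I)) ?V"
    unfolding alg
    using ideal.nonempty_connected_Spec_quotient_iff[OF B.cgenideal_ideal[OF dh] B.is_cring]
    by (simp add: B.prime_locus_PIdl[OF dh])
  have dc: "d \<in> carrier R - {\<zero>}" using d d0 by simp
  have cond_iff: "cond \<longleftrightarrow>
      (\<forall>p\<in>carrier R. ring_irreducible p \<longrightarrow> p divides d \<longrightarrow> (\<exists>i\<in>I. \<not> p divides g i))"
    unfolding cond_def no_common_irreducible_factor_def I[symmetric] g_def[symmetric] by blast
  show "nonempty_connected_space (Spec (forcing_algebra R n f f\<^sub>0))" if cond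
    unfolding iff
    using connectedin_prime_locus_forcing[where f = g, OF I g(1) g\<^sub>0(1) i(1) gi prim dc] that
    unfolding cond_iff by blast
  show "\<not> nonempty_connected_space (Spec (forcing_algebra R n f f\<^sub>0))"
    if "principal_domain R" "\<not> cond"
    unfolding iff
    using principal_domain.not_connectedin_prime_locus_forcing
        [where f = g, OF that(1) I g(1) g\<^sub>0(1) i(1) gi prim dc] that(2)
    unfolding cond_iff by blast
qed

theorem corollary4p5:
  fixes R :: "('a, 'b) ring_scheme"
    and n :: nat and f :: "nat \<Rightarrow> 'a" and f\<^sub>0 d :: 'a
  assumes "factorial_domain R"
    and "\<And>i. i \<in> {1..n} \<Longrightarrow> f i \<in> carrier R"
    and "f\<^sub>0 \<in> carrier R"
    and "is_gcd_of R d (f ` {1..n} \<union> {f\<^sub>0})"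
    and "\<exists>i\<in>{1..n}. f i \<noteq> \<zero>\<^bsub>R\<^esub>"
  shows "(no_common_irreducible_factor R ({d} \<union> (\<lambda>i. exact_quotient R (f i) d) ` {1..n})
           \<longrightarrow> nonempty_connected_space (Spec (forcing_algebra R n f f\<^sub>0)))
       \<and> (principal_domain R \<longrightarrow>
           (no_common_irreducible_factor R ({d} \<union> (\<lambda>i. exact_quotient R (f i) d) ` {1..n})
             \<longleftrightarrow> nonempty_connected_space (Spec (forcing_algebra R n f f\<^sub>0))))"
  using factorial_domain.connected_Spec_forcing_algebra[where f = f, OF assms] by blast

end
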